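(* Let $(E,\mathcal{E},m)$ be a $\sigma$-finite measure space, and let $r:E\to(0,\infty)$ be measurable and such that $\hat m(dx)=\frac{1}{r(x)}m(dx)$ is a probability measure. Let $\alpha:\mathbb{R}\to[c,d]\subset(0,2)$ and $b:\mathbb{R}\to\mathbb{R}$ be $C^1$ functions. Let $f(t,u,\cdot)$, $(t,u)\in\mathbb{R}^2$, be a family of functions such that $f(t,u,\cdot)\in\mathcal{F}_{\alpha(u)}(E,\mathcal{E},m)$ for all $(t,u)\in\mathbb{R}^2$. Let $(\Gamma_k)_{k\ge1}$ be the sequence of arrival times of a Poisson process with unit rate, let $(V_k)_{k\ge1}$ be a sequence of i.i.d. random variables with distribution $\hat m$ on $E$, and let $(\gamma_k)_{k\ge1}$ be a sequence of i.i.d. random variables with $P(\gamma_k=1)=P(\gamma_k=-1)=1/2$, the three sequences being independent. Let $$X(t,u)=b(u)\,C_{\alpha(u)}^{1/\alpha(u)}\sum_{k=1}^{\infty}\gamma_k\,\Gamma_k^{-1/\alpha(u)}\,r(V_k)^{1/\alpha(u)}f(t,u,V_k),\qquad C_\alpha=\left(\int_0^\infty x^{-\alpha}\sin(x)\,dx\right)^{-1},$$ and $Y(t)=X(t,t)$. Then for all $n\in\mathbb{N}$, $(\theta_1,\dots,\theta_n)\in\mathbb{R}^n$ and $(t_1,\dots,t_n)\in\mathbb{R}^n$, $$\mathbb{E}\left(e^{i\sum_{j=1}^{n}\theta_jY(t_j)}\right)=\exp\left(-2\int_E\int_0^{+\infty}\sin^2\left(\sum_{j=1}^{n}\theta_j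\,b(t_j)\,\frac{C_{\alpha(t_j)}^{1/\alpha(t_j)}}{2\,y^{1/\alpha(t_j)}}\,f(t_j,t_j,x)\right)dy\,m(dx)\right).$$
   Context: $\mathcal{F}_{\alpha}(E,\mathcal{E},m)$ is the set of measurable $f:E\to\mathbb{R}$ with $\int_E|f|^\alpha\,dm<\infty$. In the exponential on the left-hand side, $i$ is the imaginary unit. *)

theory Defs
  imports "HOL-Probability.Probability"
begin

definition F_space :: "real \<Rightarrow> 'e measure \<Rightarrow> ('e \<Rightarrow> real) set" where
  "F_space a m = {f \<in> borel_measurable m. (\<integral>\<^sup>+x. ennreal (\<bar>f x\<bar> powr a) \<partial>m) < \<infinity>}"

text \<open>
  The integral is the Henstock-Kurzweil one: on an unbounded set it is the limit over
  growing boxes, so it is the improper integral, which for \<open>0 < a \<le> 1\<close> converges only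
  conditionally and has no Lebesgue counterpart.
\<close>
definition C_stable :: "real \<Rightarrow> real" where
  "C_stable a = inverse (integral {0<..} (\<lambda>x. x powr (- a) * sin x))"

text \<open>
  A Poisson process as a counting process \<open>(N t)\<close>, \<open>t \<ge> 0\<close>; its values at negative times
  are irrelevant. Since the paths are nondecreasing, the truncated subtraction on
  natural numbers is the true increment.
\<close>
definition poisson_process :: "'w measure \<Rightarrow> real \<Rightarrow> (real \<Rightarrow> 'w \<Rightarrow> nat) \<Rightarrow> bool" where
  "poisson_process P rate N \<longleftrightarrow>
     (\<forall>t\<ge>0. N t \<in> measurable P (count_space UNIV)) \<and>
     (\<forall>\<omega>\<in>space P. N 0 \<omega> = 0 \<and>
        mono_on {0..} (\<lambda>t. N t \<omega>) \<and>
        (\<forall>t\<ge>0. continuous (at_right t) (\<lambda>s. N s \<omega>))) \<and>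
     (\<forall>(n::nat) \<tau>. 0 \<le> \<tau> 0 \<and> (\<forall>i<n. \<tau> i \<le> \<tau> (Suc i)) \<longrightarrow>
        prob_space.indep_vars P (\<lambda>_. count_space UNIV)
          (\<lambda>i \<omega>. N (\<tau> (Suc i)) \<omega> - N (\<tau> i) \<omega>) {..<n}) \<and>
     (\<forall>s t. 0 \<le> s \<and> s < t \<longrightarrow>
        distr P (count_space UNIV) (\<lambda>\<omega>. N t \<omega> - N s \<omega>)
          = measure_pmf (poisson_pmf (rate * (t - s))))"

definition arrival_time :: "(real \<Rightarrow> 'w \<Rightarrow> nat) \<Rightarrow> nat \<Rightarrow> 'w \<Rightarrow> real" where
  "arrival_time N k \<omega> = Inf {t. 0 \<le> t \<and> k \<le> N t \<omega>}"

definition iid_with_law ::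
  "'w measure \<Rightarrow> 's measure \<Rightarrow> 's measure \<Rightarrow> (nat \<Rightarrow> 'w \<Rightarrow> 's) \<Rightarrow> nat set \<Rightarrow> bool" where
  "iid_with_law P S \<mu> X I \<longleftrightarrow>
     prob_space.indep_vars P (\<lambda>_. S) X I \<and> (\<forall>k\<in>I. distr P S (X k) = \<mu>)"

text \<open>The events determined by the sequence \<open>(X k)\<close>, \<open>k \<ge> 1\<close>, regarded as one random element
  of the product space.\<close>
definition seq_events :: "'w measure \<Rightarrow> 's measure \<Rightarrow> (nat \<Rightarrow> 'w \<Rightarrow> 's) \<Rightarrow> 'w set set" where
  "seq_events P S X =
     {(\<lambda>\<omega>. \<lambda>k\<in>{1..}. X k \<omega>) -` A \<inter> space P | A. A \<in> sets (Pi\<^sub>M {1..} (\<lambda>_. S))}"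

definition indep_three_seqs ::
  "'w measure \<Rightarrow> 's measure \<Rightarrow> (nat \<Rightarrow> 'w \<Rightarrow> 's) \<Rightarrow> 't measure \<Rightarrow> (nat \<Rightarrow> 'w \<Rightarrow> 't) \<Rightarrow>
     'u measure \<Rightarrow> (nat \<Rightarrow> 'w \<Rightarrow> 'u) \<Rightarrow> bool" where
  "indep_three_seqs P S X T Y U Z \<longleftrightarrow>
     prob_space.indep_sets P
       (\<lambda>i. [seq_events P S X, seq_events P T Y, seq_events P U Z] ! i) {0, 1, 2::nat}"

end

theory Submission
  imports Defs
begin

text \<open>
  Put \<open>\<Phi>(y, x) = \<Sum>\<^sub>j c\<^sub>j y\<^bsup>-1/a\<^sub>j\<^esup> r(x)\<^bsup>1/a\<^sub>j\<^esup> f\<^sub>j(x)\<close> with \<open>a\<^sub>j = \<alpha>(t\<^sub>j)\<close>,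
  \<open>f\<^sub>j = f(t\<^sub>j, t\<^sub>j, \<cdot>)\<close>, and with \<open>\<theta>\<^sub>j\<close>, \<open>b(t\<^sub>j)\<close> and the normalising constants absorbed into
  \<open>c\<^sub>j\<close>. The left-hand side is then the mean of \<open>e\<^bsup>iS\<^esup>\<close> for \<open>S = \<Sum>\<^sub>k \<gamma>\<^sub>k \<Phi>(\<Gamma>\<^sub>k, V\<^sub>k)\<close>, and it is
  computed by averaging over the three independent sequences in turn (\<open>integral_decouple\<close>).
  Averaging a sign turns \<open>e\<^bsup>i\<gamma>\<Phi>\<^esup>\<close> into \<open>cos \<Phi>\<close> (\<open>char_signed_sum\<close>); averaging the mark turns
  this into \<open>h(y) = \<integral> cos \<Phi>(y, x) d\<mu>(x)\<close> (\<open>mean_cos\<close>), where \<open>\<mu>\<close> has density \<open>1 / r\<close> with respect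
  to \<open>m\<close>; and the Poisson process satisfies \<open>E \<Prod>\<^sub>k h(\<Gamma>\<^sub>k) = exp (-\<integral> (1 - h(y)) dy)\<close>
  (\<open>expectation_prod_arrivals\<close>), which for a step function \<open>h\<close> follows from the independence of the
  increments. Finally \<open>\<Phi>(y, x)\<close> depends on \<open>y\<close> only through \<open>y / r(x)\<close>, so the substitution
  \<open>y = r(x) y'\<close> cancels the density \<open>1 / r\<close> and yields the double integral of
  \<open>1 - cos = 2 sin\<^sup>2(\<cdot>/2)\<close> with respect to \<open>dy dm\<close> (\<open>integral_one_minus_mean_cos\<close>).

  Two points need analysis. First, the series defining \<open>X\<close> need not converge absolutely. A term
  exceeds \<open>u\<close> in absolute value exactly when \<open>\<Gamma>\<^sub>k < r(V\<^sub>k) |f(V\<^sub>k)|\<^sup>a u\<^bsup>-a\<^esup>\<close>, and the expected number of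
  such \<open>k\<close> is at most \<open>u\<^bsup>-a\<^esup> \<integral> |f|\<^sup>a dm\<close>; since \<open>a < 2\<close>, the squares of the terms are almost surely
  summable (\<open>nn_integral_lepage_term_finite\<close>), and random signs then give convergence by
  Kolmogorov's maximal inequality (\<open>AE_signed_sum_Cauchy\<close>). The same tail bound for Lebesgue measure
  in place of the arrival times shows that the exponent on the right is finite. Second, the identity
  for the Poisson process is applied on \<open>(0, T]\<close>, where the product is over the finitely many arrivals
  before \<open>T\<close>; the partial sums of \<open>S\<close> over these arrivals form a subsequence of all partial sums, so
  \<open>T \<rightarrow> \<infinity>\<close> is harmless (\<open>char_lepage_sum\<close>).
\<close>

section \<open>Series with random signs\<close>

text \<open>
  The walk with steps \<open>s k * a k\<close>, frozen as soon as it has left \<open>(-l, l)\<close>. Freezing turns a statement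
  about the maximum of the walk into one about its last value.
\<close>
primrec stopped_sum :: "(nat \<Rightarrow> real) \<Rightarrow> real \<Rightarrow> nat \<Rightarrow> (nat \<Rightarrow> real) \<Rightarrow> real" where
  "stopped_sum a l 0 s = 0"
| "stopped_sum a l (Suc k) s =
     stopped_sum a l k s + (if \<bar>stopped_sum a l k s\<bar> < l then s k * a k else 0)"

lemma stopped_sum_cong:
  "(\<And>i. i < k \<Longrightarrow> s i = s' i) \<Longrightarrow> stopped_sum a l k s = stopped_sum a l k s'"
  by (induction k) auto

lemma measurable_stopped_sum:
  "{..<k} \<subseteq> A \<Longrightarrow> stopped_sum a l k \<in> borel_measurable (Pi\<^sub>M A (\<lambda>_. borel))"
proof (induction k)
  case (Suc k)
  then have [measurable]: "stopped_sum a l k \<in> borel_measurable (Pi\<^sub>M A (\<lambda>_. borel))"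
    and [measurable]: "(\<lambda>s. s k) \<in> borel_measurable (Pi\<^sub>M A (\<lambda>_. borel))"
    by (auto intro!: Suc.IH measurable_component_singleton simp: lessThan_Suc)
  have "stopped_sum a l (Suc k) = (\<lambda>s. stopped_sum a l k s + (if \<bar>stopped_sum a l k s\<bar> < l then s k * a k else 0))"
    by (simp add: fun_eq_iff)
  then show ?case by simp
next
  case 0
  have "stopped_sum a l 0 = (\<lambda>_. 0)"
    by (simp add: fun_eq_iff)
  then show ?case by simp
qed

lemma stopped_sum_frozen:
  assumes "l \<le> \<bar>stopped_sum a l j s\<bar>" "j \<le> n"
  shows "stopped_sum a l n s = stopped_sum a l j s"
  using assms(2,1) by (induction n rule: dec_induct) auto

lemma stopped_sum_unstopped:
  assumes "\<bar>stopped_sum a l n s\<bar> < l" "j \<le> n"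
  shows "stopped_sum a l j s = (\<Sum>i<j. s i * a i)"
  using assms(2)
proof (induction j)
  case (Suc j)
  with assms stopped_sum_frozen[of l a j s n] have "\<bar>stopped_sum a l j s\<bar> < l"
    by (cases "\<bar>stopped_sum a l j s\<bar> < l") auto
  with Suc show ?case by simp
qed simp

lemma abs_stopped_sum_le: "\<bar>stopped_sum a l n s\<bar> \<le> (\<Sum>i<n. \<bar>s i\<bar> * \<bar>a i\<bar>)"
proof (induction n)
  case (Suc n)
  have "\<bar>stopped_sum a l (Suc n) s\<bar> \<le> \<bar>stopped_sum a l n s\<bar> + \<bar>s n * a n\<bar>"
    by (auto simp: abs_triangle_ineq)
  with Suc show ?case by (simp add: abs_mult)
qed simp

locale random_signs = prob_space +
  fixes \<epsilon> :: "nat \<Rightarrow> 'a \<Rightarrow> real"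
  assumes indep_signs: "indep_vars (\<lambda>_. borel) \<epsilon> UNIV"
    and prob_sign: "prob {\<omega>\<in>space M. \<epsilon> k \<omega> = 1} = 1 / 2" "prob {\<omega>\<in>space M. \<epsilon> k \<omega> = - 1} = 1 / 2"
begin

lemma measurable_sign [measurable]: "\<epsilon> k \<in> borel_measurable M"
  using indep_signs by (auto simp: indep_vars_def)

lemma AE_sign: "AE \<omega> in M. \<epsilon> k \<omega> = 1 \<or> \<epsilon> k \<omega> = - 1"
proof -
  have "prob {\<omega>\<in>space M. \<epsilon> k \<omega> = 1 \<or> \<epsilon> k \<omega> = - 1}
      = prob ({\<omega>\<in>space M. \<epsilon> k \<omega> = 1} \<union> {\<omega>\<in>space M. \<epsilon> k \<omega> = - 1})"
    by (rule arg_cong[where f=prob]) auto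
  also have "\<dots> = 1"
    by (subst finite_measure_Union) (auto simp: prob_sign)
  finally show ?thesis
    by (subst (asm) prob_Collect_eq_1) auto
qed

lemma expectation_sign:
  fixes \<phi> :: "real \<Rightarrow> 'b :: {banach, second_countable_topology}"
  assumes [measurable]: "\<phi> \<in> borel_measurable borel"
  shows "integrable M (\<lambda>\<omega>. \<phi> (\<epsilon> k \<omega>))"
    and "(\<integral>\<omega>. \<phi> (\<epsilon> k \<omega>) \<partial>M) = (1 / 2) *\<^sub>R (\<phi> 1 + \<phi> (- 1))"
proof -
  let ?I = "\<lambda>c. indicat_real {\<omega>\<in>space M. \<epsilon> k \<omega> = c}"
  have ae: "AE \<omega> in M. \<phi> (\<epsilon> k \<omega>) = ?I 1 \<omega> *\<^sub>R \<phi> 1 + ?I (- 1) \<omega> *\<^sub>R \<phi> (- 1)"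
    using AE_sign[of k] AE_space by eventually_elim auto
  have I: "integrable M (?I c)" for c
    by (auto intro!: integrable_real_indicator simp: emeasure_eq_measure)
  have int: "integrable M (\<lambda>\<omega>. ?I c \<omega> *\<^sub>R v)" for c and v :: 'b
    using I by (intro integrable_scaleR_left)
  show "integrable M (\<lambda>\<omega>. \<phi> (\<epsilon> k \<omega>))"
    using int ae by (subst integrable_cong_AE[OF _ _ ae]) auto
  have "(\<integral>\<omega>. \<phi> (\<epsilon> k \<omega>) \<partial>M) = (\<integral>\<omega>. ?I 1 \<omega> *\<^sub>R \<phi> 1 + ?I (- 1) \<omega> *\<^sub>R \<phi> (- 1) \<partial>M)"
    using ae by (intro integral_cong_AE) auto
  also have "\<dots> = prob {\<omega>\<in>space M. \<epsilon> k \<omega> = 1} *\<^sub>R \<phi> 1 + prob {\<omega>\<in>space M. \<epsilon> k \<omega> = - 1} *\<^sub>R \<phi> (- 1)"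
    using int I by (simp add: integral_scaleR_left Int_absorb2 Collect_conj_eq)
  also have "\<dots> = (1 / 2) *\<^sub>R (\<phi> 1 + \<phi> (- 1))"
    by (simp only: prob_sign scaleR_add_right)
  finally show "(\<integral>\<omega>. \<phi> (\<epsilon> k \<omega>) \<partial>M) = (1 / 2) *\<^sub>R (\<phi> 1 + \<phi> (- 1))" .
qed

lemma char_signed_sum:
  "(\<integral>\<omega>. exp (\<i> * complex_of_real (\<Sum>k<n. \<epsilon> k \<omega> * a k)) \<partial>M) = complex_of_real (\<Prod>k<n. cos (a k))"
proof -
  have "(\<integral>\<omega>. exp (\<i> * complex_of_real (\<Sum>k<n. \<epsilon> k \<omega> * a k)) \<partial>M)
      = (\<integral>\<omega>. (\<Prod>k<n. exp (\<i> * complex_of_real (\<epsilon> k \<omega> * a k))) \<partial>M)"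
    by (simp add: sum_distrib_left exp_sum)
  also have "\<dots> = (\<Prod>k<n. \<integral>\<omega>. exp (\<i> * complex_of_real (\<epsilon> k \<omega> * a k)) \<partial>M)"
  proof (rule indep_vars_lebesgue_integral)
    have "indep_vars (\<lambda>_. borel) \<epsilon> {..<n}"
      using indep_signs by (rule indep_vars_subset) auto
    then show "indep_vars (\<lambda>_. borel) (\<lambda>k \<omega>. exp (\<i> * complex_of_real (\<epsilon> k \<omega> * a k))) {..<n}"
      by (rule indep_vars_compose2[where M'="\<lambda>_. borel"]) measurable
    show "integrable M (\<lambda>\<omega>. exp (\<i> * complex_of_real (\<epsilon> k \<omega> * a k)))" for k
      by (rule expectation_sign(1)[of "\<lambda>x. exp (\<i> * complex_of_real (x * a k))"]) measurable
  qed simp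
  also have "(\<lambda>k. \<integral>\<omega>. exp (\<i> * complex_of_real (\<epsilon> k \<omega> * a k)) \<partial>M) = (\<lambda>k. complex_of_real (cos (a k)))"
  proof
    fix k
    have "(\<integral>\<omega>. exp (\<i> * complex_of_real (\<epsilon> k \<omega> * a k)) \<partial>M)
        = (1 / 2) *\<^sub>R (exp (\<i> * complex_of_real (1 * a k)) + exp (\<i> * complex_of_real (- 1 * a k)))"
      by (rule expectation_sign(2)[of "\<lambda>x. exp (\<i> * complex_of_real (x * a k))"]) measurable
    also have "\<dots> = complex_of_real (cos (a k))"
      by (simp add: cos_exp_eq[of "complex_of_real (a k)"] cos_of_real[symmetric] scaleR_conv_of_real)
    finally show "(\<integral>\<omega>. exp (\<i> * complex_of_real (\<epsilon> k \<omega> * a k)) \<partial>M) = complex_of_real (cos (a k))" .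
  qed
  finally show ?thesis by simp
qed

text \<open>
  Whether the walk still moves at time \<open>k\<close> is decided by the earlier signs, which are independent of the
  sign \<open>\<epsilon> k\<close> of mean zero.
\<close>
lemma stopped_sum_step_uncorrelated:
  assumes [measurable]: "\<psi> \<in> borel_measurable borel" and bd: "\<And>x. \<bar>\<psi> x\<bar> \<le> C"
  shows "(\<integral>\<omega>. \<psi> (stopped_sum a l k (\<lambda>i. \<epsilon> i \<omega>)) * \<epsilon> k \<omega> \<partial>M) = 0"
proof -
  have T: "(\<lambda>\<omega>. \<psi> (stopped_sum a l k (\<lambda>i. \<epsilon> i \<omega>))) = (\<lambda>\<omega>. \<psi> (stopped_sum a l k (\<lambda>i\<in>{..<k}. \<epsilon> i \<omega>)))"
    by (intro ext arg_cong[where f=\<psi>] stopped_sum_cong) auto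
  have m: "stopped_sum a l k \<in> borel_measurable (Pi\<^sub>M {..<k} (\<lambda>_. borel))"
    by (rule measurable_stopped_sum) simp
  have "indep_var (Pi\<^sub>M {..<k} (\<lambda>_. borel)) (\<lambda>\<omega>. \<lambda>i\<in>{..<k}. \<epsilon> i \<omega>)
      (Pi\<^sub>M {k} (\<lambda>_. borel)) (\<lambda>\<omega>. \<lambda>i\<in>{k}. \<epsilon> i \<omega>)"
    by (rule indep_var_restrict[OF indep_signs]) auto
  then have "indep_var borel ((\<lambda>s. \<psi> (stopped_sum a l k s)) \<circ> (\<lambda>\<omega>. \<lambda>i\<in>{..<k}. \<epsilon> i \<omega>))
     borel ((\<lambda>s. s k) \<circ> (\<lambda>\<omega>. \<lambda>i\<in>{k}. \<epsilon> i \<omega>))"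
    by (rule indep_var_compose) (use m in \<open>auto intro!: measurable_component_singleton\<close>)
  then have ind: "indep_var borel (\<lambda>\<omega>. \<psi> (stopped_sum a l k (\<lambda>i. \<epsilon> i \<omega>))) borel (\<epsilon> k)"
    by (simp add: comp_def T)
  have "(\<integral>\<omega>. \<psi> (stopped_sum a l k (\<lambda>i. \<epsilon> i \<omega>)) * \<epsilon> k \<omega> \<partial>M)
     = (\<integral>\<omega>. \<psi> (stopped_sum a l k (\<lambda>i. \<epsilon> i \<omega>)) \<partial>M) * (\<integral>\<omega>. \<epsilon> k \<omega> \<partial>M)"
  proof (rule indep_var_lebesgue_integral[OF ind])
    show "integrable M (\<lambda>\<omega>. \<psi> (stopped_sum a l k (\<lambda>i. \<epsilon> i \<omega>)))"
      by (rule integrable_const_bound[where B=C])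
         (use indep_var_rv1[OF ind] bd in auto)
    show "integrable M (\<epsilon> k)"
      using expectation_sign(1)[of "\<lambda>x. x" k] by simp
  qed
  also have "(\<integral>\<omega>. \<epsilon> k \<omega> \<partial>M) = 0"
    using expectation_sign(2)[of "\<lambda>x. x" k] by simp
  finally show ?thesis by simp
qed

lemma measurable_stopped_sum_sign [measurable]:
  "(\<lambda>\<omega>. stopped_sum a l k (\<lambda>i. \<epsilon> i \<omega>)) \<in> borel_measurable M"
  by (rule measurable_compose[OF measurable_PiM_single' measurable_stopped_sum[of k UNIV]])
     (auto simp: space_PiM)

lemma AE_stopped_sum_bound:
  "AE \<omega> in M. \<bar>stopped_sum a l n (\<lambda>i. \<epsilon> i \<omega>)\<bar> \<le> (\<Sum>i<n. \<bar>a i\<bar>)"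
proof -
  have "AE \<omega> in M. \<forall>k. \<epsilon> k \<omega> = 1 \<or> \<epsilon> k \<omega> = - 1"
    by (simp add: AE_all_countable AE_sign)
  then show ?thesis
  proof eventually_elim
    case (elim \<omega>)
    then have "\<bar>\<epsilon> i \<omega>\<bar> = 1" for i
      by (metis abs_minus_cancel abs_one)
    with abs_stopped_sum_le[of a l n "\<lambda>i. \<epsilon> i \<omega>"] show ?case by simp
  qed
qed

text \<open>
  In the expansion of the square the cross terms have mean zero, so that step \<open>i\<close> adds at most \<open>(a i)\<^sup>2\<close>.
\<close>
lemma stopped_sum_second_moment:
  "integrable M (\<lambda>\<omega>. (stopped_sum a l n (\<lambda>i. \<epsilon> i \<omega>))\<^sup>2)"
  "(\<integral>\<omega>. (stopped_sum a l n (\<lambda>i. \<epsilon> i \<omega>))\<^sup>2 \<partial>M) \<le> (\<Sum>i<n. (a i)\<^sup>2)"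
proof -
  let ?T = "\<lambda>n \<omega>. stopped_sum a l n (\<lambda>i. \<epsilon> i \<omega>)"
  show int: "integrable M (\<lambda>\<omega>. (?T n \<omega>)\<^sup>2)" for n
  proof (rule integrable_const_bound[where B="(\<Sum>i<n. \<bar>a i\<bar>)\<^sup>2"])
    show "AE \<omega> in M. norm ((?T n \<omega>)\<^sup>2) \<le> (\<Sum>i<n. \<bar>a i\<bar>)\<^sup>2"
      using AE_stopped_sum_bound[of a l n]
    proof eventually_elim
      case (elim \<omega>)
      then show ?case using power_mono[OF elim, of 2] by simp
    qed
  qed measurable
  show "(\<integral>\<omega>. (?T n \<omega>)\<^sup>2 \<partial>M) \<le> (\<Sum>i<n. (a i)\<^sup>2)"
  proof (induction n)
    case (Suc n)
    define \<psi> where "\<psi> x = (if \<bar>x\<bar> < l then 2 * x * a n else 0)" for x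
    have [measurable]: "\<psi> \<in> borel_measurable borel"
      unfolding \<psi>_def by measurable
    have "\<bar>\<psi> x\<bar> \<le> 2 * \<bar>l\<bar> * \<bar>a n\<bar>" for x
      by (auto simp: \<psi>_def abs_mult intro!: mult_right_mono)
    note unc = stopped_sum_step_uncorrelated[OF \<open>\<psi> \<in> _\<close> this, where a=a and l=l and k=n]
    have int2: "integrable M (\<lambda>\<omega>. \<psi> (?T n \<omega>) * \<epsilon> n \<omega>)"
    proof (rule integrable_const_bound[where B="2 * \<bar>l\<bar> * \<bar>a n\<bar>"])
      show "AE \<omega> in M. norm (\<psi> (?T n \<omega>) * \<epsilon> n \<omega>) \<le> 2 * \<bar>l\<bar> * \<bar>a n\<bar>"
        using AE_sign[of n] by eventually_elim (use \<open>\<And>x. \<bar>\<psi> x\<bar> \<le> _\<close> in auto)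
    qed measurable
    have "AE \<omega> in M. (?T (Suc n) \<omega>)\<^sup>2 \<le> (?T n \<omega>)\<^sup>2 + \<psi> (?T n \<omega>) * \<epsilon> n \<omega> + (a n)\<^sup>2"
      using AE_sign[of n] by eventually_elim (auto simp: \<psi>_def power2_eq_square algebra_simps)
    then have "(\<integral>\<omega>. (?T (Suc n) \<omega>)\<^sup>2 \<partial>M) \<le> (\<integral>\<omega>. (?T n \<omega>)\<^sup>2 + \<psi> (?T n \<omega>) * \<epsilon> n \<omega> + (a n)\<^sup>2 \<partial>M)"
      by (intro integral_mono_AE int int2 Bochner_Integration.integrable_add) simp_all
    also have "\<dots> = (\<integral>\<omega>. (?T n \<omega>)\<^sup>2 \<partial>M) + (a n)\<^sup>2"
      using int int2 unc by (simp add: prob_space)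
    finally show ?case using Suc by simp
  qed simp
qed

text \<open>
  Kolmogorov's maximal inequality: a walk that leaves \<open>(-l, l)\<close> before time \<open>n\<close> is frozen outside, so
  Chebyshev's inequality for the frozen walk at time \<open>n\<close> applies.
\<close>
lemma signed_sum_maximal_inequality:
  assumes "0 < l"
  shows "prob {\<omega>\<in>space M. \<exists>j\<le>n. l \<le> \<bar>\<Sum>i<j. \<epsilon> i \<omega> * a i\<bar>} \<le> (\<Sum>i<n. (a i)\<^sup>2) / l\<^sup>2"
proof -
  let ?T = "\<lambda>\<omega>. stopped_sum a l n (\<lambda>i. \<epsilon> i \<omega>)"
  have "prob {\<omega>\<in>space M. \<exists>j\<le>n. l \<le> \<bar>\<Sum>i<j. \<epsilon> i \<omega> * a i\<bar>} \<le> prob {\<omega>\<in>space M. l\<^sup>2 \<le> (?T \<omega>)\<^sup>2}"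
  proof (rule finite_measure_mono)
    show "{\<omega>\<in>space M. \<exists>j\<le>n. l \<le> \<bar>\<Sum>i<j. \<epsilon> i \<omega> * a i\<bar>} \<subseteq> {\<omega>\<in>space M. l\<^sup>2 \<le> (?T \<omega>)\<^sup>2}"
    proof safe
      fix \<omega> j assume "j \<le> n" "l \<le> \<bar>\<Sum>i<j. \<epsilon> i \<omega> * a i\<bar>"
      then have "\<not> \<bar>?T \<omega>\<bar> < l"
        using stopped_sum_unstopped[of a l n "\<lambda>i. \<epsilon> i \<omega>" j]
          stopped_sum_frozen[of l a j "\<lambda>i. \<epsilon> i \<omega>" n] by force
      then show "l\<^sup>2 \<le> (?T \<omega>)\<^sup>2"
        using assms power_mono[of l "\<bar>?T \<omega>\<bar>" 2] by simp
    qed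
  qed measurable
  also have "\<dots> \<le> (\<integral>\<omega>. (?T \<omega>)\<^sup>2 \<partial>M) / l\<^sup>2"
    using integral_Markov_inequality_measure[of M "\<lambda>\<omega>. (?T \<omega>)\<^sup>2" "space M" "l\<^sup>2"]
      stopped_sum_second_moment(1)[of a l n] assms by simp
  also have "\<dots> \<le> (\<Sum>i<n. (a i)\<^sup>2) / l\<^sup>2"
    by (intro divide_right_mono stopped_sum_second_moment) simp
  finally show ?thesis .
qed

text \<open>
  The maximal inequality bounds the oscillation of the partial sums after time \<open>m\<close> by the tail
  \<open>\<Sum>i. (a (i + m))\<^sup>2\<close>, which tends to zero.
\<close>
lemma AE_signed_sum_Cauchy:
  assumes "summable (\<lambda>i. (a i)\<^sup>2)"
  shows "AE \<omega> in M. Cauchy (\<lambda>n. \<Sum>i<n. \<epsilon> i \<omega> * a i)"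
proof -
  define S where "S n \<omega> = (\<Sum>i<n. \<epsilon> i \<omega> * a i)" for n \<omega>
  have [measurable]: "S n \<in> borel_measurable M" for n
    unfolding S_def by measurable
  have tail: "prob {\<omega>\<in>space M. \<exists>n\<ge>m. l \<le> \<bar>S n \<omega> - S m \<omega>\<bar>} \<le> (\<Sum>i. (a (i + m))\<^sup>2) / l\<^sup>2"
    if "0 < l" for m and l :: real
  proof -
    \<comment> \<open>With the coefficients before \<open>m\<close> deleted, the partial sums from time \<open>m\<close> on are increments.\<close>
    define a' where "a' i = (if m \<le> i then a i else 0)" for i
    have S': "S n \<omega> - S m \<omega> = (\<Sum>i<n. \<epsilon> i \<omega> * a' i)" if "m \<le> n" for n \<omega>
    proof -
      have "S n \<omega> - S m \<omega> = (\<Sum>i\<in>{m..<n}. \<epsilon> i \<omega> * a i)"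
        using that sum_diff_nat_ivl[of 0 m n "\<lambda>i. \<epsilon> i \<omega> * a i"]
        by (simp add: S_def atLeast0LessThan)
      also have "\<dots> = (\<Sum>i<n. \<epsilon> i \<omega> * a' i)"
        by (rule sum.mono_neutral_cong_left) (auto simp: a'_def)
      finally show ?thesis .
    qed
    define A where "A n = {\<omega>\<in>space M. \<exists>j\<le>n. l \<le> \<bar>\<Sum>i<j. \<epsilon> i \<omega> * a' i\<bar>}" for n
    have [measurable]: "A n \<in> sets M" for n
      unfolding A_def by measurable
    have "(\<lambda>n. prob (A n)) \<longlonglongrightarrow> prob (\<Union>n. A n)"
      by (rule finite_Lim_measure_incseq) (auto simp: incseq_def A_def, meson order_trans)
    moreover have "prob (A n) \<le> (\<Sum>i. (a (i + m))\<^sup>2) / l\<^sup>2" for n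
    proof -
      have "prob (A n) \<le> (\<Sum>i<n. (a' i)\<^sup>2) / l\<^sup>2"
        unfolding A_def by (rule signed_sum_maximal_inequality) fact
      also have "(\<Sum>i<n. (a' i)\<^sup>2) \<le> (\<Sum>i<m + n. (a' i)\<^sup>2)"
        by (rule sum_mono2) auto
      also have "\<dots> = (\<Sum>i<m. (a' i)\<^sup>2) + (\<Sum>i<n. (a' (i + m))\<^sup>2)"
        by (induction n) (simp_all add: ac_simps)
      also have "\<dots> = (\<Sum>i<n. (a (i + m))\<^sup>2)"
        by (simp add: a'_def)
      also have "\<dots> \<le> (\<Sum>i. (a (i + m))\<^sup>2)"
        using assms by (intro sum_le_suminf) (auto simp: summable_iff_shift[of "\<lambda>i. (a i)\<^sup>2"])
      finally show ?thesis by (simp add: divide_right_mono)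
    qed
    ultimately have "prob (\<Union>n. A n) \<le> (\<Sum>i. (a (i + m))\<^sup>2) / l\<^sup>2"
      by (blast intro: LIMSEQ_le_const2)
    moreover have "{\<omega>\<in>space M. \<exists>n\<ge>m. l \<le> \<bar>S n \<omega> - S m \<omega>\<bar>} \<subseteq> (\<Union>n. A n)"
      by (auto simp: A_def S') blast
    then have "prob {\<omega>\<in>space M. \<exists>n\<ge>m. l \<le> \<bar>S n \<omega> - S m \<omega>\<bar>} \<le> prob (\<Union>n. A n)"
      by (rule finite_measure_mono) measurable
    ultimately show ?thesis by simp
  qed
  have "AE \<omega> in M. \<exists>m. \<forall>n\<ge>m. \<bar>S n \<omega> - S m \<omega>\<bar> < inverse (Suc j)" for j
  proof (rule AE_I')
    let ?l = "inverse (real (Suc j))"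
    let ?B = "{\<omega>\<in>space M. \<forall>m. \<exists>n\<ge>m. ?l \<le> \<bar>S n \<omega> - S m \<omega>\<bar>}"
    show "{\<omega>\<in>space M. \<not> (\<exists>m. \<forall>n\<ge>m. \<bar>S n \<omega> - S m \<omega>\<bar> < ?l)} \<subseteq> ?B"
      by (auto simp: not_less)
    have le: "prob ?B \<le> (\<Sum>i. (a (i + m))\<^sup>2) / ?l\<^sup>2" for m
    proof -
      have "prob ?B \<le> prob {\<omega>\<in>space M. \<exists>n\<ge>m. ?l \<le> \<bar>S n \<omega> - S m \<omega>\<bar>}"
        by (rule finite_measure_mono) auto
      also note tail[of ?l m]
      finally show ?thesis by simp
    qed
    have "(\<lambda>m. (\<Sum>i. (a (i + m))\<^sup>2) / ?l\<^sup>2) \<longlonglongrightarrow> 0 / ?l\<^sup>2"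
      by (intro tendsto_divide suminf_exist_split2 assms tendsto_const) simp
    then have "prob ?B \<le> 0 / ?l\<^sup>2"
      by (rule LIMSEQ_le_const) (use le in blast)
    then have "prob ?B = 0"
      by (simp add: measure_le_0_iff)
    then show "?B \<in> null_sets M"
      by (simp add: null_sets_def emeasure_eq_measure)
  qed
  then have "AE \<omega> in M. \<forall>j. \<exists>m. \<forall>n\<ge>m. \<bar>S n \<omega> - S m \<omega>\<bar> < inverse (Suc j)"
    by (simp add: AE_all_countable)
  then show ?thesis
  proof eventually_elim
    case (elim \<omega>)
    show ?case
      unfolding S_def[symmetric] Cauchy_altdef2
    proof safe
      fix e :: real assume "0 < e"
      then obtain j where "inverse (real (Suc j)) < e"
        using reals_Archimedean by blast
      with elim show "\<exists>N. \<forall>n\<ge>N. dist (S n \<omega>) (S N \<omega>) < e"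
        unfolding dist_real_def by (meson less_trans)
    qed
  qed
qed

end

section \<open>Decoupling independent sequences\<close>

lemma Int_stable_vimages: "Int_stable {X -` A \<inter> \<Omega> | A. A \<in> sets S}"
proof (rule Int_stableI, safe)
  fix A B assume "A \<in> sets S" "B \<in> sets S"
  then show "\<exists>C. X -` A \<inter> \<Omega> \<inter> (X -` B \<inter> \<Omega>) = X -` C \<inter> \<Omega> \<and> C \<in> sets S"
    by (intro exI[of _ "A \<inter> B"]) auto
qed

text \<open>
  The three random elements take values in different spaces, so their independence is expressed by the
  events that they generate and not by a family of random variables.
\<close>
locale independent_triple = prob_space +
  fixes S :: "'s measure" and X :: "'a \<Rightarrow> 's" and T :: "'t measure" and Y :: "'a \<Rightarrow> 't"
    and U :: "'u measure" and Z :: "'a \<Rightarrow> 'u"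
  assumes measurable_X [measurable]: "X \<in> measurable M S"
    and measurable_Y [measurable]: "Y \<in> measurable M T"
    and measurable_Z [measurable]: "Z \<in> measurable M U"
    and indep: "indep_sets (\<lambda>i. [{X -` A \<inter> space M | A. A \<in> sets S}, {Y -` A \<inter> space M | A. A \<in> sets T},
      {Z -` A \<inter> space M | A. A \<in> sets U}] ! i) {0, 1, 2::nat}"
begin

text \<open>
  Independence of the last two components is read off on rectangles. The first component is independent
  of the pair because the events generated by the pair lie in the \<open>\<sigma>\<close>-algebra generated by two
  intersection-stable classes.
\<close>
lemma joint_law:
  "distr M (S \<Otimes>\<^sub>M (T \<Otimes>\<^sub>M U)) (\<lambda>\<omega>. (X \<omega>, Y \<omega>, Z \<omega>)) = distr M S X \<Otimes>\<^sub>M (distr M T Y \<Otimes>\<^sub>M distr M U Z)"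
proof -
  let ?E = "\<lambda>i. [{X -` A \<inter> space M | A. A \<in> sets S}, {Y -` A \<inter> space M | A. A \<in> sets T},
      {Z -` A \<inter> space M | A. A \<in> sets U}] ! i"
  interpret PX: prob_space "distr M S X" by (rule prob_space_distr) measurable
  interpret PY: prob_space "distr M T Y" by (rule prob_space_distr) measurable
  interpret PZ: prob_space "distr M U Z" by (rule prob_space_distr) measurable
  interpret PYZ: prob_space "distr M (T \<Otimes>\<^sub>M U) (\<lambda>\<omega>. (Y \<omega>, Z \<omega>))" by (rule prob_space_distr) measurable
  have YZ: "distr M T Y \<Otimes>\<^sub>M distr M U Z = distr M (T \<Otimes>\<^sub>M U) (\<lambda>\<omega>. (Y \<omega>, Z \<omega>))"
  proof (rule pair_measure_eqI)
    fix B C assume "B \<in> sets (distr M T Y)" "C \<in> sets (distr M U Z)"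
    then have BC [measurable]: "B \<in> sets T" "C \<in> sets U" by auto
    define A where "A = (\<lambda>i::nat. if i = 1 then Y -` B \<inter> space M else Z -` C \<inter> space M)"
    have "prob (\<Inter>i\<in>{1,2}. A i) = (\<Prod>i\<in>{1,2}. prob (A i))"
      by (rule indep_setsD[OF indep]) (use BC in \<open>auto simp: A_def\<close>)
    moreover have "(\<Inter>i\<in>{1,2}. A i) = (\<lambda>\<omega>. (Y \<omega>, Z \<omega>)) -` (B \<times> C) \<inter> space M"
      by (auto simp: A_def)
    ultimately have "prob ((\<lambda>\<omega>. (Y \<omega>, Z \<omega>)) -` (B \<times> C) \<inter> space M)
        = prob (Y -` B \<inter> space M) * prob (Z -` C \<inter> space M)"
      by (simp add: A_def)
    then show "emeasure (distr M T Y) B * emeasure (distr M U Z) C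
        = emeasure (distr M (T \<Otimes>\<^sub>M U) (\<lambda>\<omega>. (Y \<omega>, Z \<omega>))) (B \<times> C)"
      by (simp add: emeasure_distr emeasure_eq_measure ennreal_mult')
  qed (auto simp: PY.sigma_finite_measure_axioms PZ.sigma_finite_measure_axioms intro!: sets_pair_measure_cong)
  have "distr M S X \<Otimes>\<^sub>M distr M (T \<Otimes>\<^sub>M U) (\<lambda>\<omega>. (Y \<omega>, Z \<omega>))
      = distr M (S \<Otimes>\<^sub>M (T \<Otimes>\<^sub>M U)) (\<lambda>\<omega>. (X \<omega>, Y \<omega>, Z \<omega>))"
  proof (rule pair_measure_eqI)
    fix A D assume "A \<in> sets (distr M S X)" "D \<in> sets (distr M (T \<Otimes>\<^sub>M U) (\<lambda>\<omega>. (Y \<omega>, Z \<omega>)))"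
    then have AD [measurable]: "A \<in> sets S" "D \<in> sets (T \<Otimes>\<^sub>M U)" by auto
    let ?I = "\<lambda>j::nat. if j = 0 then {0} else {1, 2::nat}"
    have "indep_sets (\<lambda>j. sigma_sets (space M) (\<Union>i\<in>?I j. ?E i)) {0, 1}"
    proof (rule indep_sets_collect_sigma)
      show "indep_sets ?E (\<Union>j\<in>{0, 1}. ?I j)"
        by (rule back_subst[of "indep_sets ?E", OF indep]) auto
      show "disjoint_family_on ?I {0, 1}"
        by (auto simp: disjoint_family_on_def)
      show "Int_stable (?E i)" if "j \<in> {0, 1}" "i \<in> ?I j" for i j
        using that by (auto split: if_splits intro: Int_stable_vimages)
    qed
    then have ind: "indep_sets (\<lambda>j::nat. if j = 0 then sigma_sets (space M) (?E 0) else sigma_sets (space M) (?E 1 \<union> ?E 2)) {0, 1}"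
      by (rule indep_sets_mono_sets) auto
    let ?G = "sigma (space M) (?E 1 \<union> ?E 2)"
    have sp: "?E 1 \<union> ?E 2 \<subseteq> Pow (space M)" by auto
    have "Y \<in> measurable ?G T"
      by (rule measurableI) (use measurable_space[OF measurable_Y] sp in auto)
    moreover have "Z \<in> measurable ?G U"
      by (rule measurableI) (use measurable_space[OF measurable_Z] sp in auto)
    ultimately have "(\<lambda>\<omega>. (Y \<omega>, Z \<omega>)) \<in> measurable ?G (T \<Otimes>\<^sub>M U)"
      by (rule measurable_Pair)
    from measurable_sets[OF this AD(2)]
    have D: "(\<lambda>\<omega>. (Y \<omega>, Z \<omega>)) -` D \<inter> space M \<in> sigma_sets (space M) (?E 1 \<union> ?E 2)"
      using sp by simp
    define B where "B = (\<lambda>i::nat. if i = 0 then X -` A \<inter> space M else (\<lambda>\<omega>. (Y \<omega>, Z \<omega>)) -` D \<inter> space M)"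
    have "prob (\<Inter>i\<in>{0,1}. B i) = (\<Prod>i\<in>{0,1}. prob (B i))"
      by (rule indep_setsD[OF ind]) (use D AD in \<open>auto simp: B_def intro!: sigma_sets.Basic\<close>)
    moreover have "(\<Inter>i\<in>{0,1}. B i) = (\<lambda>\<omega>. (X \<omega>, Y \<omega>, Z \<omega>)) -` (A \<times> D) \<inter> space M"
      by (auto simp: B_def)
    ultimately have "prob ((\<lambda>\<omega>. (X \<omega>, Y \<omega>, Z \<omega>)) -` (A \<times> D) \<inter> space M)
        = prob (X -` A \<inter> space M) * prob ((\<lambda>\<omega>. (Y \<omega>, Z \<omega>)) -` D \<inter> space M)"
      by (simp add: B_def)
    then show "emeasure (distr M S X) A * emeasure (distr M (T \<Otimes>\<^sub>M U) (\<lambda>\<omega>. (Y \<omega>, Z \<omega>))) D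
        = emeasure (distr M (S \<Otimes>\<^sub>M (T \<Otimes>\<^sub>M U)) (\<lambda>\<omega>. (X \<omega>, Y \<omega>, Z \<omega>))) (A \<times> D)"
      by (simp add: emeasure_distr emeasure_eq_measure ennreal_mult')
  qed (auto simp: PX.sigma_finite_measure_axioms PYZ.sigma_finite_measure_axioms intro!: sets_pair_measure_cong)
  with YZ show ?thesis by simp
qed

text \<open>
  Each component may be sampled from its own copy of the probability space. In the inner integrals the
  outer components are then constants, which replaces conditional expectations.
\<close>
lemma integral_decouple:
  fixes \<phi> :: "'s \<times> 't \<times> 'u \<Rightarrow> 'c :: {banach, second_countable_topology}"
  assumes [measurable]: "\<phi> \<in> borel_measurable (S \<Otimes>\<^sub>M (T \<Otimes>\<^sub>M U))" and bd: "\<And>p. norm (\<phi> p) \<le> C"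
  shows "(\<integral>\<omega>. \<phi> (X \<omega>, Y \<omega>, Z \<omega>) \<partial>M) = (\<integral>\<omega>1. \<integral>\<omega>2. \<integral>\<omega>3. \<phi> (X \<omega>1, Y \<omega>2, Z \<omega>3) \<partial>M \<partial>M \<partial>M)"
proof -
  let ?\<mu> = "distr M S X" and ?\<nu> = "distr M T Y" and ?\<rho> = "distr M U Z"
  interpret PX: prob_space ?\<mu> by (rule prob_space_distr) measurable
  interpret PY: prob_space ?\<nu> by (rule prob_space_distr) measurable
  interpret PZ: prob_space ?\<rho> by (rule prob_space_distr) measurable
  interpret YZ: pair_prob_space ?\<nu> ?\<rho> ..
  interpret XYZ: pair_prob_space ?\<mu> "?\<nu> \<Otimes>\<^sub>M ?\<rho>" ..
  have "(\<integral>\<omega>. \<phi> (X \<omega>, Y \<omega>, Z \<omega>) \<partial>M) = (\<integral>p. \<phi> p \<partial>(?\<mu> \<Otimes>\<^sub>M (?\<nu> \<Otimes>\<^sub>M ?\<rho>)))"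
    unfolding joint_law[symmetric] by (subst integral_distr) auto
  also have "\<dots> = (\<integral>x. \<integral>p. \<phi> (x, p) \<partial>(?\<nu> \<Otimes>\<^sub>M ?\<rho>) \<partial>?\<mu>)"
    by (rule XYZ.integral_fst'[symmetric])
       (auto intro!: XYZ.P.integrable_const_bound[where B=C] simp: bd)
  also have "\<dots> = (\<integral>x. \<integral>y. \<integral>z. \<phi> (x, y, z) \<partial>?\<rho> \<partial>?\<nu> \<partial>?\<mu>)"
  proof (rule Bochner_Integration.integral_cong[OF refl])
    fix x assume "x \<in> space ?\<mu>"
    then have [measurable]: "x \<in> space S" by simp
    show "(\<integral>p. \<phi> (x, p) \<partial>(?\<nu> \<Otimes>\<^sub>M ?\<rho>)) = (\<integral>y. \<integral>z. \<phi> (x, y, z) \<partial>?\<rho> \<partial>?\<nu>)"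
      by (rule YZ.integral_fst'[symmetric])
         (auto intro!: YZ.P.integrable_const_bound[where B=C] simp: bd)
  qed
  also have "\<dots> = (\<integral>x. \<integral>y. \<integral>\<omega>3. \<phi> (x, y, Z \<omega>3) \<partial>M \<partial>?\<nu> \<partial>?\<mu>)"
    by (intro Bochner_Integration.integral_cong refl integral_distr) (auto simp: )
  also have "\<dots> = (\<integral>x. \<integral>\<omega>2. \<integral>\<omega>3. \<phi> (x, Y \<omega>2, Z \<omega>3) \<partial>M \<partial>M \<partial>?\<mu>)"
    by (intro Bochner_Integration.integral_cong refl integral_distr) (auto simp: )
  also have "\<dots> = (\<integral>\<omega>1. \<integral>\<omega>2. \<integral>\<omega>3. \<phi> (X \<omega>1, Y \<omega>2, Z \<omega>3) \<partial>M \<partial>M \<partial>M)"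
    by (intro integral_distr) (auto simp: )
  finally show ?thesis .
qed

text \<open>
  The previous identity for the indicator of the exceptional set.
\<close>
lemma AE_decouple:
  assumes [measurable]: "Measurable.pred (S \<Otimes>\<^sub>M (T \<Otimes>\<^sub>M U)) Q"
    and ae: "AE \<omega>1 in M. AE \<omega>2 in M. AE \<omega>3 in M. Q (X \<omega>1, Y \<omega>2, Z \<omega>3)"
  shows "AE \<omega> in M. Q (X \<omega>, Y \<omega>, Z \<omega>)"
proof -
  let ?I = "\<lambda>p. if Q p then 0 else 1 :: real"
  have "(\<integral>\<omega>. ?I (X \<omega>, Y \<omega>, Z \<omega>) \<partial>M) = (\<integral>\<omega>1. \<integral>\<omega>2. \<integral>\<omega>3. ?I (X \<omega>1, Y \<omega>2, Z \<omega>3) \<partial>M \<partial>M \<partial>M)"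
    by (rule integral_decouple[where C=1]) auto
  also have "\<dots> = 0"
  proof (rule integral_eq_zero_AE)
    show "AE \<omega>1 in M. (\<integral>\<omega>2. \<integral>\<omega>3. ?I (X \<omega>1, Y \<omega>2, Z \<omega>3) \<partial>M \<partial>M) = 0"
      using ae
    proof eventually_elim
      case (elim \<omega>1)
      then have "AE \<omega>2 in M. (\<integral>\<omega>3. ?I (X \<omega>1, Y \<omega>2, Z \<omega>3) \<partial>M) = 0"
        by eventually_elim (auto intro!: integral_eq_zero_AE)
      then show ?case by (rule integral_eq_zero_AE)
    qed
  qed
  finally have "(\<integral>\<omega>. ?I (X \<omega>, Y \<omega>, Z \<omega>) \<partial>M) = 0" .
  then have "AE \<omega> in M. ?I (X \<omega>, Y \<omega>, Z \<omega>) = 0"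
    by (subst (asm) integral_nonneg_eq_0_iff_AE) (auto intro!: integrable_const_bound[where B=1])
  then show ?thesis
    by eventually_elim (auto split: if_splits)
qed

end

text \<open>
  The sequences of the model start at index 1, series and products at index 0; re-indexing does not
  create new events.
\<close>
lemma measurable_of_seq_events:
  fixes X :: "nat \<Rightarrow> 'a \<Rightarrow> 'b"
  assumes ev: "seq_events P S X \<subseteq> sets P" and sp: "\<And>k \<omega>. 1 \<le> k \<Longrightarrow> \<omega> \<in> space P \<Longrightarrow> X k \<omega> \<in> space S"
  shows "(\<lambda>\<omega> k. X (Suc k) \<omega>) \<in> measurable P (Pi\<^sub>M UNIV (\<lambda>_. S))"
    and "{(\<lambda>\<omega> k. X (Suc k) \<omega>) -` A \<inter> space P | A. A \<in> sets (Pi\<^sub>M UNIV (\<lambda>_. S))} \<subseteq> seq_events P S X"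
proof -
  let ?R = "\<lambda>\<omega>. \<lambda>k\<in>{1..}. X k \<omega>"
  let ?s = "\<lambda>s k. s (Suc k) :: 'b"
  have R: "?R \<in> measurable P (Pi\<^sub>M {1..} (\<lambda>_. S))"
    by (rule measurableI) (use sp ev in \<open>auto simp: space_PiM seq_events_def\<close>)
  have s: "?s \<in> measurable (Pi\<^sub>M {1..} (\<lambda>_. S)) (Pi\<^sub>M UNIV (\<lambda>_. S))"
    by (rule measurable_PiM_single') (auto simp: space_PiM PiE_iff intro!: measurable_component_singleton)
  have eq: "(\<lambda>\<omega> k. X (Suc k) \<omega>) = ?s \<circ> ?R"
    by (auto simp: fun_eq_iff)
  show "(\<lambda>\<omega> k. X (Suc k) \<omega>) \<in> measurable P (Pi\<^sub>M UNIV (\<lambda>_. S))"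
    unfolding eq using R s by (rule measurable_comp)
  show "{(\<lambda>\<omega> k. X (Suc k) \<omega>) -` A \<inter> space P | A. A \<in> sets (Pi\<^sub>M UNIV (\<lambda>_. S))} \<subseteq> seq_events P S X"
  proof safe
    fix A :: "(nat \<Rightarrow> 'b) set" assume "A \<in> sets (Pi\<^sub>M UNIV (\<lambda>_. S))"
    then have "?s -` A \<inter> space (Pi\<^sub>M {1..} (\<lambda>_. S)) \<in> sets (Pi\<^sub>M {1..} (\<lambda>_. S))"
      by (rule measurable_sets[OF s])
    moreover have "(\<lambda>\<omega> k. X (Suc k) \<omega>) -` A \<inter> space P
        = ?R -` (?s -` A \<inter> space (Pi\<^sub>M {1..} (\<lambda>_. S))) \<inter> space P"
      using measurable_space[OF R] unfolding eq vimage_comp[symmetric] by blast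
    ultimately show "(\<lambda>\<omega> k. X (Suc k) \<omega>) -` A \<inter> space P \<in> seq_events P S X"
      unfolding seq_events_def by blast
  qed
qed

lemma (in prob_space) indep_vars_shift_index:
  assumes "indep_vars (\<lambda>_. S) X {1..}"
  shows "indep_vars (\<lambda>_. S) (\<lambda>k. X (Suc k)) UNIV"
proof -
  let ?E = "\<lambda>i. sigma_sets (space M) {X i -` A \<inter> space M | A. A \<in> sets S}"
  have rv: "\<And>k. X (Suc k) \<in> measurable M S" and ind: "indep_sets ?E {1..}"
    using assms by (auto simp: indep_vars_def)
  have "indep_sets (\<lambda>k. ?E (Suc k)) UNIV"
  proof (rule indep_setsI)
    show "?E (Suc k) \<subseteq> events" for k
      using ind by (auto simp: indep_sets_def)
    fix A J assume J: "J \<noteq> {}" "J \<subseteq> UNIV" "finite (J :: nat set)" "\<forall>j\<in>J. A j \<in> ?E (Suc j)"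
    have "prob (\<Inter>i\<in>Suc ` J. A (i - 1)) = (\<Prod>i\<in>Suc ` J. prob (A (i - 1)))"
      by (rule indep_setsD[OF ind]) (use J in auto)
    then show "prob (\<Inter>j\<in>J. A j) = (\<Prod>j\<in>J. prob (A j))"
      by (simp add: prod.reindex)
  qed
  with rv show ?thesis by (simp add: indep_vars_def)
qed

section \<open>Arrival times of the unit-rate Poisson process\<close>

lemma poisson_pmf_pgf:
  fixes z rate :: real
  assumes rate: "0 < rate"
  shows "measure_pmf.expectation (poisson_pmf rate) (\<lambda>n. z ^ n) = exp (rate * (z - 1))"
proof -
  have sums: "(\<lambda>n. pmf (poisson_pmf rate) n *\<^sub>R z ^ n) sums (exp (rate * z) * exp (- rate))"
    using sums_mult2[OF exp_converges[of "rate * z"], of "exp (- rate)"] rate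
    by (simp add: field_simps power_mult_distrib)
  have "summable (\<lambda>n. norm (pmf (poisson_pmf rate) n *\<^sub>R z ^ n))"
    using summable_mult2[OF summable_norm_exp[of "rate * z"], of "exp (- rate)"] rate
    by (simp add: field_simps power_mult_distrib abs_mult power_abs)
  then have int: "integrable (count_space UNIV) (\<lambda>n. pmf (poisson_pmf rate) n *\<^sub>R z ^ n)"
    by (simp add: integrable_count_space_nat_iff)
  have "measure_pmf.expectation (poisson_pmf rate) (\<lambda>n. z ^ n)
      = (\<integral>n. pmf (poisson_pmf rate) n *\<^sub>R z ^ n \<partial>count_space UNIV)"
    unfolding measure_pmf_eq_density by (subst integral_density) auto
  also have "\<dots> = (\<Sum>n. pmf (poisson_pmf rate) n *\<^sub>R z ^ n)"
    by (rule integral_count_space_nat) fact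
  also have "\<dots> = exp (rate * z) * exp (- rate)"
    using sums by (rule sums_unique[symmetric])
  also have "\<dots> = exp (rate * (z - 1))"
    by (simp add: exp_add[symmetric] algebra_simps)
  finally show ?thesis .
qed

lemma poisson_pmf_mean:
  assumes rate: "0 < rate"
  shows "(\<integral>\<^sup>+n. of_nat n \<partial>measure_pmf (poisson_pmf rate)) = ennreal rate"
proof -
  have "(\<lambda>n. rate * (rate ^ n / fact n * exp (- rate))) sums (rate * (exp rate * exp (- rate)))"
    using exp_converges[of rate] by (intro sums_mult sums_mult2) (simp add: field_simps)
  then have "(\<lambda>n. rate ^ Suc n / fact n * exp (- rate)) sums rate"
    by (simp add: exp_minus field_simps)
  moreover have "rate ^ Suc n / fact n * exp (- rate) = real (Suc n) * pmf (poisson_pmf rate) (Suc n)" for n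
    using rate by (simp add: divide_simps del: of_nat_Suc)
  ultimately have "(\<lambda>n. real (Suc n) * pmf (poisson_pmf rate) (Suc n)) sums rate"
    by simp
  then have sums: "(\<lambda>n. real n * pmf (poisson_pmf rate) n) sums rate"
    by (subst (asm) sums_Suc_iff) simp
  have "(\<integral>\<^sup>+n. of_nat n \<partial>measure_pmf (poisson_pmf rate))
      = (\<integral>\<^sup>+n. ennreal (real n * pmf (poisson_pmf rate) n) \<partial>count_space UNIV)"
    by (subst nn_integral_measure_pmf)
       (auto intro!: nn_integral_cong simp: ennreal_mult' ennreal_of_nat_eq_real_of_nat mult.commute)
  also have "\<dots> = (\<Sum>n. ennreal (real n * pmf (poisson_pmf rate) n))"
    by (rule nn_integral_count_space_nat)
  also have "\<dots> = ennreal rate"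
    using sums by (subst suminf_ennreal2) (auto simp: sums_iff)
  finally show ?thesis .
qed

text \<open>
  Times are rounded up to multiples of \<open>\<delta>\<close>, because the increment of \<open>N\<close> over a grid cell counts the
  arrivals in the half-open interval that contains its right end point.
\<close>
definition grid_ceiling :: "real \<Rightarrow> real \<Rightarrow> real" where
  "grid_ceiling \<delta> y = \<delta> * real_of_int \<lceil>y / \<delta>\<rceil>"

lemma grid_ceiling_bounds:
  assumes "0 < \<delta>"
  shows "y \<le> grid_ceiling \<delta> y" "grid_ceiling \<delta> y < y + \<delta>"
proof -
  have "\<delta> * (y / \<delta>) \<le> \<delta> * of_int \<lceil>y / \<delta>\<rceil>"
    using assms by (intro mult_left_mono) auto
  with assms show "y \<le> grid_ceiling \<delta> y"
    by (simp add: grid_ceiling_def)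
  have "\<delta> * of_int \<lceil>y / \<delta>\<rceil> < \<delta> * (y / \<delta> + 1)"
    using assms by (intro mult_strict_left_mono) linarith+
  with assms show "grid_ceiling \<delta> y < y + \<delta>"
    by (simp add: grid_ceiling_def algebra_simps)
qed

lemma grid_ceiling_eq:
  assumes "0 < \<delta>" "\<delta> * real i < y" "y \<le> \<delta> * real (Suc i)"
  shows "grid_ceiling \<delta> y = \<delta> * real (Suc i)"
proof -
  have "\<lceil>y / \<delta>\<rceil> = int (Suc i)"
    using assms by (intro ceiling_unique) (simp_all add: field_simps)
  then show ?thesis by (simp add: grid_ceiling_def)
qed

lemma measurable_grid_ceiling:
  fixes h :: "real \<Rightarrow> 'b :: topological_space"
  shows "(\<lambda>y. h (grid_ceiling \<delta> y)) \<in> borel_measurable borel"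
proof -
  have "(\<lambda>y. h (grid_ceiling \<delta> y)) = (\<lambda>k. h (\<delta> * real_of_int k)) \<circ> (\<lambda>y. \<lceil>y / \<delta>\<rceil>)"
    by (simp add: fun_eq_iff grid_ceiling_def)
  also have "\<dots> \<in> borel_measurable borel"
    by (rule measurable_comp[where N="count_space UNIV"]) simp_all
  finally show ?thesis .
qed

lemma tendsto_grid_ceiling:
  assumes \<delta>: "\<And>p. 0 < \<delta> p" "\<delta> \<longlonglongrightarrow> 0"
  shows "(\<lambda>p. grid_ceiling (\<delta> p) y) \<longlonglongrightarrow> y"
proof (rule tendsto_sandwich)
  show "(\<lambda>_. y) \<longlonglongrightarrow> y" by simp
  show "(\<lambda>p. y + \<delta> p) \<longlonglongrightarrow> y"
    using tendsto_add[OF tendsto_const[of y] \<delta>(2)] by simp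
qed (use grid_ceiling_bounds[OF \<delta>(1)] in \<open>auto intro!: always_eventually less_imp_le\<close>)

lemma set_integrable_bounded_interval:
  fixes g :: "real \<Rightarrow> real"
  assumes [measurable]: "g \<in> borel_measurable borel" and "\<And>y. \<bar>g y\<bar> \<le> C"
  shows "set_integrable lborel {a<..b} g"
  unfolding set_integrable_def
proof (rule integrableI_bounded_set_indicator[where B=C])
  show "emeasure lborel {a<..b} < \<infinity>"
    by (cases "a \<le> b") simp_all
qed (use assms in auto)

lemma integral_grid_step:
  fixes h :: "real \<Rightarrow> real"
  assumes \<delta>: "0 < \<delta>" and h: "\<And>y. \<bar>h y\<bar> \<le> C"
  shows "(LINT y:{0<..\<delta> * real n}|lborel. h (grid_ceiling \<delta> y)) = (\<Sum>i<n. \<delta> * h (\<delta> * real (Suc i)))"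
proof (induction n)
  case 0
  then show ?case by (simp add: set_lebesgue_integral_def)
next
  case (Suc n)
  note [measurable] = measurable_grid_ceiling
  let ?g = "\<lambda>y. h (grid_ceiling \<delta> y)"
  have int: "set_integrable lborel {a<..b} ?g" for a b
    using h by (intro set_integrable_bounded_interval[where C=C]) auto
  have split: "{0<..\<delta> * real (Suc n)} = {0<..\<delta> * real n} \<union> {\<delta> * real n<..\<delta> * real (Suc n)}"
    using \<delta> by (intro ivl_disj_un_two(6)[symmetric]) (simp_all add: mult_left_mono)
  have "(LINT y:{0<..\<delta> * real (Suc n)}|lborel. ?g y)
      = (LINT y:{0<..\<delta> * real n}|lborel. ?g y) + (LINT y:{\<delta> * real n<..\<delta> * real (Suc n)}|lborel. ?g y)"
    unfolding split by (rule set_integral_Un) (use int in auto)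
  also have "(LINT y:{\<delta> * real n<..\<delta> * real (Suc n)}|lborel. ?g y)
      = (LINT y:{\<delta> * real n<..\<delta> * real (Suc n)}|lborel. h (\<delta> * real (Suc n)))"
    by (rule set_lebesgue_integral_cong) (use grid_ceiling_eq[OF \<delta>] in auto)
  also have "\<dots> = \<delta> * h (\<delta> * real (Suc n))"
    using \<delta> by (simp add: set_integral_const algebra_simps)
  finally show ?case using Suc by simp
qed

locale unit_poisson_process = prob_space +
  fixes N :: "real \<Rightarrow> 'a \<Rightarrow> nat"
  assumes poisson: "poisson_process M 1 N"
begin

lemma measurable_count: "0 \<le> t \<Longrightarrow> N t \<in> measurable M (count_space UNIV)"
  using poisson by (simp add: poisson_process_def)

lemma count_0: "\<omega> \<in> space M \<Longrightarrow> N 0 \<omega> = 0"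
  using poisson by (simp add: poisson_process_def)

lemma count_mono: "\<omega> \<in> space M \<Longrightarrow> 0 \<le> s \<Longrightarrow> s \<le> t \<Longrightarrow> N s \<omega> \<le> N t \<omega>"
  using poisson by (auto simp: poisson_process_def intro: mono_onD)

lemma eventually_count_right:
  assumes "\<omega> \<in> space M" "0 \<le> t"
  shows "eventually (\<lambda>s. N s \<omega> = N t \<omega>) (at_right t)"
proof -
  have "continuous (at_right t) (\<lambda>s. N s \<omega>)"
    using poisson assms by (simp add: poisson_process_def)
  then have "((\<lambda>s. N s \<omega>) \<longlongrightarrow> N t \<omega>) (at_right t)"
    by (simp add: continuous_within)
  then show ?thesis
    by (simp add: tendsto_discrete)
qed

lemma increment_law:
  assumes "0 \<le> s" "s < t"
  shows "distr M (count_space UNIV) (\<lambda>\<omega>. N t \<omega> - N s \<omega>) = measure_pmf (poisson_pmf (t - s))"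
  using poisson assms by (simp add: poisson_process_def)

lemma measurable_increment:
  assumes "0 \<le> s" "0 \<le> t"
  shows "(\<lambda>\<omega>. N t \<omega> - N s \<omega>) \<in> measurable M (count_space UNIV)"
proof -
  note [measurable] = measurable_count[OF assms(1)] measurable_count[OF assms(2)]
  show ?thesis by measurable
qed

lemma increment_pgf:
  assumes "0 \<le> s" "s < t"
  shows "(\<integral>\<omega>. z ^ (N t \<omega> - N s \<omega>) \<partial>M) = exp ((t - s) * (z - 1 :: real))"
proof -
  have "(\<integral>\<omega>. z ^ (N t \<omega> - N s \<omega>) \<partial>M)
      = (\<integral>n. z ^ n \<partial>distr M (count_space UNIV) (\<lambda>\<omega>. N t \<omega> - N s \<omega>))"
    using assms by (subst integral_distr) (auto intro!: measurable_increment)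
  then show ?thesis
    using assms by (simp add: increment_law poisson_pmf_pgf)
qed

lemma count_mean:
  assumes "0 \<le> t"
  shows "(\<integral>\<^sup>+\<omega>. of_nat (N t \<omega>) \<partial>M) = ennreal t"
proof (cases "t = 0")
  case True
  have "(\<integral>\<^sup>+\<omega>. of_nat (N t \<omega>) \<partial>M) = (\<integral>\<^sup>+\<omega>. 0 \<partial>M)"
    by (rule nn_integral_cong) (simp add: True count_0)
  with True show ?thesis by simp
next
  case False
  with assms have t: "0 < t" by simp
  have "(\<integral>\<^sup>+\<omega>. of_nat (N t \<omega>) \<partial>M) = (\<integral>\<^sup>+\<omega>. of_nat (N t \<omega> - N 0 \<omega>) \<partial>M)"
    by (rule nn_integral_cong) (simp add: count_0)
  also have "\<dots> = (\<integral>\<^sup>+n. of_nat n \<partial>distr M (count_space UNIV) (\<lambda>\<omega>. N t \<omega> - N 0 \<omega>))"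
    using assms by (subst nn_integral_distr) (auto intro!: measurable_increment)
  also have "\<dots> = ennreal t"
    using increment_law[of 0 t] t by (simp add: poisson_pmf_mean)
  finally show ?thesis .
qed

text \<open>
  Markov's inequality for \<open>(1/2) ^ N n\<close>, whose mean \<open>exp (- n / 2)\<close> tends to zero.
\<close>
lemma AE_count_unbounded: "AE \<omega> in M. \<forall>k. \<exists>n::nat. k \<le> N (real n) \<omega>"
proof -
  note [measurable] = measurable_count
  have "AE \<omega> in M. \<exists>n::nat. k \<le> N (real n) \<omega>" for k
  proof (rule AE_I')
    let ?B = "{\<omega>\<in>space M. \<forall>n::nat. N (real n) \<omega> < k}"
    show "{\<omega>\<in>space M. \<not> (\<exists>n::nat. k \<le> N (real n) \<omega>)} \<subseteq> ?B"
      by (auto simp: not_le)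
    have le: "prob ?B \<le> 2 ^ k * exp (- (1 / 2) * real n)" if "1 \<le> n" for n :: nat
    proof -
      have int: "integrable M (\<lambda>\<omega>. (1 / 2 :: real) ^ N (real n) \<omega>)"
        by (rule integrable_const_bound[where B=1]) (auto simp: power_le_one)
      have "prob ?B \<le> prob {\<omega>\<in>space M. (1 / 2 :: real) ^ k \<le> (1 / 2) ^ N (real n) \<omega>}"
      proof (rule finite_measure_mono)
        have "(1 / 2 :: real) ^ k \<le> (1 / 2) ^ N (real n) \<omega>" if "N (real n) \<omega> < k" for \<omega>
          using that by (intro power_decreasing) auto
        then show "?B \<subseteq> {\<omega>\<in>space M. (1 / 2 :: real) ^ k \<le> (1 / 2) ^ N (real n) \<omega>}"
          by blast
      qed measurable
      also have "\<dots> \<le> (\<integral>\<omega>. (1 / 2 :: real) ^ N (real n) \<omega> \<partial>M) / (1 / 2) ^ k"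
        using integral_Markov_inequality_measure[OF int, of "space M" "(1/2)^k"] by simp
      also have "(\<integral>\<omega>. (1 / 2 :: real) ^ N (real n) \<omega> \<partial>M) = (\<integral>\<omega>. (1 / 2 :: real) ^ (N (real n) \<omega> - N 0 \<omega>) \<partial>M)"
        by (rule Bochner_Integration.integral_cong) (simp_all add: count_0)
      also have "\<dots> = exp (- (1 / 2) * real n)"
        using that increment_pgf[of 0 "real n" "1 / 2"] by simp
      finally show ?thesis by (simp add: field_simps power_one_over)
    qed
    have "(\<lambda>n. 2 ^ k * exp (- (1 / 2) * real n)) \<longlonglongrightarrow> 0"
      by real_asymp
    then have "prob ?B \<le> 0"
      by (rule LIMSEQ_le_const) (use le in blast)
    then have "prob ?B = 0"
      by (simp add: measure_le_0_iff)
    then show "?B \<in> null_sets M"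
      by (simp add: null_sets_def emeasure_eq_measure)
  qed
  then show ?thesis by (simp add: AE_all_countable)
qed

text \<open>
  By right continuity the infimum that defines the arrival time is attained. Unboundedness of the path
  excludes the infimum of the empty set, which is an unspecified real number.
\<close>
lemma arrival_time_le_iff:
  assumes \<omega>: "\<omega> \<in> space M" and ub: "\<forall>k. \<exists>n::nat. k \<le> N (real n) \<omega>" and t: "0 \<le> t"
  shows "arrival_time N k \<omega> \<le> t \<longleftrightarrow> k \<le> N t \<omega>"
proof -
  define A where "A = {t. 0 \<le> t \<and> k \<le> N t \<omega>}"
  have arr: "arrival_time N k \<omega> = Inf A"
    by (simp add: arrival_time_def A_def)
  obtain n :: nat where "k \<le> N (real n) \<omega>" using ub by blast
  then have "real n \<in> A" by (simp add: A_def)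
  then have ne: "A \<noteq> {}" by blast
  have bdd: "bdd_below A" by (auto simp: A_def bdd_below_def)
  have Inf0: "0 \<le> Inf A"
    using ne by (intro cInf_greatest) (auto simp: A_def)
  have "Inf A \<in> A"
  proof -
    obtain e where e: "Inf A < e" "\<And>s. Inf A < s \<Longrightarrow> s < e \<Longrightarrow> N s \<omega> = N (Inf A) \<omega>"
      using eventually_count_right[OF \<omega> Inf0] unfolding eventually_at_right_field by blast
    obtain a where a: "a \<in> A" "a < e"
      using cInf_lessD[OF ne e(1)] by blast
    have "Inf A \<le> a" using a bdd by (intro cInf_lower)
    then have "N a \<omega> = N (Inf A) \<omega>"
      using e(2)[of a] a by (cases "a = Inf A") auto
    with a Inf0 show ?thesis by (simp add: A_def)
  qed
  then have "k \<le> N (Inf A) \<omega>" by (simp add: A_def)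
  then have "Inf A \<le> t \<Longrightarrow> k \<le> N t \<omega>"
    using count_mono[OF \<omega> Inf0] by (meson order_trans)
  moreover have "k \<le> N t \<omega> \<Longrightarrow> Inf A \<le> t"
    using t bdd by (intro cInf_lower) (auto simp: A_def)
  ultimately show ?thesis by (auto simp: arr)
qed

lemma arrival_time_pos:
  assumes \<omega>: "\<omega> \<in> space M" and ub: "\<forall>k. \<exists>n::nat. k \<le> N (real n) \<omega>"
  shows "0 < arrival_time N (Suc k) \<omega>"
  using arrival_time_le_iff[OF \<omega> ub, of 0 "Suc k"] count_0[OF \<omega>] by simp

text \<open>
  The sum is the expected number of arrivals before \<open>c\<close>, hence at most the mean of \<open>N c\<close>. Through this
  bound on their intensity the arrival times enter the convergence of the series.
\<close>
lemma suminf_arrival_before: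
  assumes "0 \<le> c"
  shows "(\<Sum>k. emeasure M {\<omega>\<in>space M. arrival_time N (Suc k) \<omega> < c}) \<le> ennreal c"
proof -
  note [measurable] = measurable_count[OF assms]
  have "(\<Sum>k. emeasure M {\<omega>\<in>space M. arrival_time N (Suc k) \<omega> < c}) \<le> (\<Sum>k. emeasure M {\<omega>\<in>space M. k < N c \<omega>})"
  proof (rule suminf_le)
    fix k
    show "emeasure M {\<omega>\<in>space M. arrival_time N (Suc k) \<omega> < c} \<le> emeasure M {\<omega>\<in>space M. k < N c \<omega>}"
    proof (rule emeasure_mono_AE)
      show "AE \<omega> in M. \<omega> \<in> {\<omega>\<in>space M. arrival_time N (Suc k) \<omega> < c} \<longrightarrow> \<omega> \<in> {\<omega>\<in>space M. k < N c \<omega>}"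
        using AE_count_unbounded AE_space
        by eventually_elim (use arrival_time_le_iff assms in \<open>force simp: Suc_le_eq[symmetric]\<close>)
    qed measurable
  qed auto
  also have "\<dots> = ennreal c"
    using nn_integral_nat_function[of "N c" M] count_mean[OF assms] by simp
  finally show ?thesis .
qed

text \<open>
  All arrivals in one cell contribute the same factor, and their number is an increment of \<open>N\<close>.
\<close>
lemma prod_arrivals_grid_step:
  fixes h :: "real \<Rightarrow> real"
  assumes \<omega>: "\<omega> \<in> space M" and ub: "\<forall>k. \<exists>n::nat. k \<le> N (real n) \<omega>" and \<delta>: "0 < \<delta>"
  shows "(\<Prod>k<N (\<delta> * real n) \<omega>. h (grid_ceiling \<delta> (arrival_time N (Suc k) \<omega>)))
       = (\<Prod>i<n. h (\<delta> * real (Suc i)) ^ (N (\<delta> * real (Suc i)) \<omega> - N (\<delta> * real i) \<omega>))"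
proof (induction n)
  case 0
  then show ?case by (simp add: count_0[OF \<omega>])
next
  case (Suc n)
  let ?a = "N (\<delta> * real n) \<omega>" and ?b = "N (\<delta> * real (Suc n)) \<omega>"
  let ?g = "\<lambda>k. h (grid_ceiling \<delta> (arrival_time N (Suc k) \<omega>))"
  have ab: "?a \<le> ?b"
    using \<delta> by (intro count_mono[OF \<omega>]) (simp_all add: mult_left_mono)
  have "{..<?b} = {..<?a} \<union> {?a..<?b}"
    using ab by auto
  then have "(\<Prod>k<?b. ?g k) = (\<Prod>k<?a. ?g k) * (\<Prod>k\<in>{?a..<?b}. ?g k)"
    by (simp add: prod.union_disjoint ivl_disj_int)
  also have "(\<Prod>k\<in>{?a..<?b}. ?g k) = (\<Prod>k\<in>{?a..<?b}. h (\<delta> * real (Suc n)))"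
  proof (rule prod.cong[OF refl])
    fix k assume k: "k \<in> {?a..<?b}"
    have "\<delta> * real n < arrival_time N (Suc k) \<omega>"
      using k \<delta> arrival_time_le_iff[OF \<omega> ub, of "\<delta> * real n" "Suc k"] by (simp add: not_le[symmetric])
    moreover have "arrival_time N (Suc k) \<omega> \<le> \<delta> * real (Suc n)"
      using k \<delta> arrival_time_le_iff[OF \<omega> ub, of "\<delta> * real (Suc n)" "Suc k"] by (simp del: of_nat_Suc)
    ultimately show "?g k = h (\<delta> * real (Suc n))"
      using \<delta> by (subst grid_ceiling_eq) auto
  qed
  also have "\<dots> = h (\<delta> * real (Suc n)) ^ (?b - ?a)"
    by simp
  finally show ?case using Suc by simp
qed

lemma measurable_random_prod:
  fixes g :: "nat \<Rightarrow> 'a \<Rightarrow> real"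
  assumes "0 \<le> t" and [measurable]: "\<And>k. g k \<in> borel_measurable M"
  shows "(\<lambda>\<omega>. \<Prod>k<N t \<omega>. g k \<omega>) \<in> borel_measurable M"
  by (rule measurable_compose_countable[where f="\<lambda>n \<omega>. \<Prod>k<n. g k \<omega>" and g="N t", OF _ measurable_count[OF assms(1)]])
     measurable

text \<open>
  Independent increments reduce the expectation to generating functions of Poisson distributions, whose
  exponents add up to the integral of a step function.
\<close>
lemma expectation_prod_grid_step:
  fixes h :: "real \<Rightarrow> real"
  assumes [measurable]: "\<And>k. arrival_time N (Suc k) \<in> borel_measurable M"
    and \<delta>: "0 < \<delta>" and h: "\<And>y. \<bar>h y\<bar> \<le> 1"
  shows "(\<integral>\<omega>. (\<Prod>k<N (\<delta> * real n) \<omega>. h (grid_ceiling \<delta> (arrival_time N (Suc k) \<omega>))) \<partial>M)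
       = exp (- (LINT y:{0<..\<delta> * real n}|lborel. 1 - h (grid_ceiling \<delta> y)))"
proof -
  note [measurable] = measurable_grid_ceiling
  let ?inc = "\<lambda>i \<omega>. N (\<delta> * real (Suc i)) \<omega> - N (\<delta> * real i) \<omega>"
  have inc: "?inc i \<in> measurable M (count_space UNIV)" for i
    using \<delta> by (intro measurable_increment) simp_all
  have pow: "(\<lambda>\<omega>. c ^ ?inc i \<omega>) \<in> borel_measurable M" for c :: real and i
    by (rule measurable_compose[OF inc]) simp
  have "(\<integral>\<omega>. (\<Prod>k<N (\<delta> * real n) \<omega>. h (grid_ceiling \<delta> (arrival_time N (Suc k) \<omega>))) \<partial>M)
      = (\<integral>\<omega>. (\<Prod>i<n. h (\<delta> * real (Suc i)) ^ ?inc i \<omega>) \<partial>M)"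
  proof (rule integral_cong_AE)
    show "(\<lambda>\<omega>. \<Prod>k<N (\<delta> * real n) \<omega>. h (grid_ceiling \<delta> (arrival_time N (Suc k) \<omega>))) \<in> borel_measurable M"
      using \<delta> by (intro measurable_random_prod) simp_all
    show "AE \<omega> in M. (\<Prod>k<N (\<delta> * real n) \<omega>. h (grid_ceiling \<delta> (arrival_time N (Suc k) \<omega>)))
        = (\<Prod>i<n. h (\<delta> * real (Suc i)) ^ ?inc i \<omega>)"
      using AE_count_unbounded AE_space
      by eventually_elim (rule prod_arrivals_grid_step[OF _ _ \<delta>])
  qed (intro borel_measurable_prod pow)
  also have "\<dots> = (\<Prod>i<n. \<integral>\<omega>. h (\<delta> * real (Suc i)) ^ ?inc i \<omega> \<partial>M)"
  proof (rule indep_vars_lebesgue_integral)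
    have "indep_vars (\<lambda>_. count_space UNIV) ?inc {..<n}"
      using poisson \<delta> unfolding poisson_process_def
      by (auto simp: mult_left_mono elim!: allE[of _ "\<lambda>i. \<delta> * real i"])
    then show "indep_vars (\<lambda>_. borel) (\<lambda>i \<omega>. h (\<delta> * real (Suc i)) ^ ?inc i \<omega>) {..<n}"
      by (rule indep_vars_compose2[where M'="\<lambda>_. count_space UNIV"]) simp
    show "integrable M (\<lambda>\<omega>. h (\<delta> * real (Suc i)) ^ ?inc i \<omega>)" for i
    proof (rule integrable_const_bound[where B=1])
      have "norm (h y ^ k) \<le> 1" for y k
        using h[of y] unfolding real_norm_def power_abs by (intro power_le_one) auto
      then show "AE \<omega> in M. norm (h (\<delta> * real (Suc i)) ^ ?inc i \<omega>) \<le> 1"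
        by blast
    qed (rule pow)
  qed simp
  also have "\<dots> = (\<Prod>i<n. exp (\<delta> * (h (\<delta> * real (Suc i)) - 1)))"
  proof (rule prod.cong[OF refl])
    fix i
    have "\<delta> * real (Suc i) - \<delta> * real i = \<delta>" "0 \<le> \<delta> * real i"
      using \<delta> by (simp_all add: distrib_left)
    moreover from this \<delta> have "\<delta> * real i < \<delta> * real (Suc i)"
      by linarith
    ultimately show "(\<integral>\<omega>. h (\<delta> * real (Suc i)) ^ ?inc i \<omega> \<partial>M) = exp (\<delta> * (h (\<delta> * real (Suc i)) - 1))"
      by (simp only: increment_pgf)
  qed
  also have "\<dots> = exp (- (\<Sum>i<n. \<delta> * (1 - h (\<delta> * real (Suc i)))))"
  proof -
    have "(\<Sum>i<n. \<delta> * (h (\<delta> * real (Suc i)) - 1)) = - (\<Sum>i<n. \<delta> * (1 - h (\<delta> * real (Suc i))))"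
      by (simp add: sum_negf[symmetric] right_diff_distrib)
    then show ?thesis
      using exp_sum[of "{..<n}" "\<lambda>i. \<delta> * (h (\<delta> * real (Suc i)) - 1)"] by simp
  qed
  also have "(\<Sum>i<n. \<delta> * (1 - h (\<delta> * real (Suc i)))) = (LINT y:{0<..\<delta> * real n}|lborel. 1 - h (grid_ceiling \<delta> y))"
  proof (rule integral_grid_step[symmetric, where h="\<lambda>y. 1 - h y" and C=2])
    show "\<bar>1 - h y\<bar> \<le> 2" for y using h[of y] by linarith
  qed fact
  finally show ?thesis .
qed

text \<open>
  The generating functional of the Poisson process on \<open>(0, T]\<close>, obtained by refining the grid.
  The functions \<open>h\<close> to which this is applied may oscillate near 0, so continuity is asked on the open
  half-line, which contains all arrivals.
\<close>
lemma expectation_prod_arrivals: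
  fixes h :: "real \<Rightarrow> real"
  assumes meas [measurable]: "h \<in> borel_measurable borel" "\<And>k. arrival_time N (Suc k) \<in> borel_measurable M"
    and h: "\<And>y. \<bar>h y\<bar> \<le> 1" and cont: "continuous_on {0<..} h" and T: "0 < T"
  shows "(\<integral>\<omega>. (\<Prod>k<N T \<omega>. h (arrival_time N (Suc k) \<omega>)) \<partial>M) = exp (- (LINT y:{0<..T}|lborel. 1 - h y))"
proof -
  note [measurable] = measurable_grid_ceiling
  define \<delta> where "\<delta> p = T / real (Suc p)" for p
  have \<delta>: "0 < \<delta> p" "\<delta> p * real (Suc p) = T" for p
    using T by (simp_all add: \<delta>_def)
  have \<delta>0: "\<delta> \<longlonglongrightarrow> 0"
    unfolding \<delta>_def by real_asymp
  have lim: "(\<lambda>p. h (grid_ceiling (\<delta> p) y)) \<longlonglongrightarrow> h y" if "0 < y" for y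
  proof (rule isCont_tendsto_compose[OF _ tendsto_grid_ceiling[OF \<delta>(1) \<delta>0]])
    show "isCont h y"
      using cont that by (simp add: continuous_on_eq_continuous_at)
  qed
  have bound: "norm (\<Prod>k<n. g k) \<le> 1" if "\<And>k. \<bar>g k\<bar> \<le> 1" for g :: "nat \<Rightarrow> real" and n
    using that by (simp add: abs_prod prod_le_1)
  have "(\<lambda>p. \<integral>\<omega>. (\<Prod>k<N T \<omega>. h (grid_ceiling (\<delta> p) (arrival_time N (Suc k) \<omega>))) \<partial>M)
      \<longlonglongrightarrow> (\<integral>\<omega>. (\<Prod>k<N T \<omega>. h (arrival_time N (Suc k) \<omega>)) \<partial>M)"
  proof (rule integral_dominated_convergence[where w="\<lambda>_. 1"])
    show "AE \<omega> in M. (\<lambda>p. \<Prod>k<N T \<omega>. h (grid_ceiling (\<delta> p) (arrival_time N (Suc k) \<omega>)))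
        \<longlonglongrightarrow> (\<Prod>k<N T \<omega>. h (arrival_time N (Suc k) \<omega>))"
      using AE_count_unbounded AE_space
      by eventually_elim (auto intro!: tendsto_prod lim arrival_time_pos)
    show "AE \<omega> in M. norm (\<Prod>k<N T \<omega>. h (grid_ceiling (\<delta> p) (arrival_time N (Suc k) \<omega>))) \<le> 1" for p
      using h by (intro AE_I2 bound)
  qed (use T in \<open>auto intro!: measurable_random_prod\<close>)
  moreover have "(\<lambda>p. exp (- (LINT y:{0<..T}|lborel. 1 - h (grid_ceiling (\<delta> p) y))))
      \<longlonglongrightarrow> exp (- (LINT y:{0<..T}|lborel. 1 - h y))"
  proof (intro tendsto_intros)
    show "(\<lambda>p. LINT y:{0<..T}|lborel. 1 - h (grid_ceiling (\<delta> p) y)) \<longlonglongrightarrow> (LINT y:{0<..T}|lborel. 1 - h y)"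
      unfolding set_lebesgue_integral_def
    proof (rule integral_dominated_convergence[where w="\<lambda>y. indicator {0<..T} y *\<^sub>R 2"])
      show "integrable lborel (\<lambda>y. indicator {0<..T} y *\<^sub>R (2::real))"
        using set_integrable_bounded_interval[of "\<lambda>_. 2" 2 0 T] by (simp add: set_integrable_def)
      show "AE y in lborel. (\<lambda>p. indicator {0<..T} y *\<^sub>R (1 - h (grid_ceiling (\<delta> p) y)))
          \<longlonglongrightarrow> indicator {0<..T} y *\<^sub>R (1 - h y)"
        by (intro AE_I2) (auto simp: indicator_def intro!: tendsto_intros lim)
      show "AE y in lborel. norm (indicator {0<..T} y *\<^sub>R (1 - h (grid_ceiling (\<delta> p) y))) \<le> indicator {0<..T} y *\<^sub>R 2" for p
      proof (intro AE_I2)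
        fix y
        have "\<bar>1 - h (grid_ceiling (\<delta> p) y)\<bar> \<le> 2"
          using h[of "grid_ceiling (\<delta> p) y"] by linarith
        then show "norm (indicator {0<..T} y *\<^sub>R (1 - h (grid_ceiling (\<delta> p) y))) \<le> indicator {0<..T} y *\<^sub>R 2"
          by (simp add: indicator_def)
      qed
    qed measurable
  qed
  moreover have "(\<integral>\<omega>. (\<Prod>k<N T \<omega>. h (grid_ceiling (\<delta> p) (arrival_time N (Suc k) \<omega>))) \<partial>M)
      = exp (- (LINT y:{0<..T}|lborel. 1 - h (grid_ceiling (\<delta> p) y)))" for p
    using expectation_prod_grid_step[OF meas(2) \<delta>(1)[of p], where h=h and n="Suc p", OF h] unfolding \<delta>(2) .
  ultimately show ?thesis
    by (simp add: LIMSEQ_unique)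
qed

end

section \<open>Tails, and the change of variables between the two intensities\<close>

text \<open>
  If \<open>2\<^bsup>-(j+1)\<^esup> < x \<le> 2\<^bsup>-j\<^esup>\<close>, then \<open>x\<^sup>2 \<le> 4\<^bsup>-j\<^esup>\<close>; for \<open>x > 1\<close> the term \<open>j = 0\<close> suffices.
\<close>
lemma min_one_square_le_dyadic_sum:
  fixes x :: real
  assumes "0 \<le> x"
  shows "ennreal (min 1 (x\<^sup>2)) \<le> (\<Sum>j. ennreal ((1/4)^j) * indicator {y. (1/2)^Suc j < y} x)"
proof (cases "x = 0")
  case False
  with assms have "0 < x" by simp
  have "\<exists>j. (1/2 :: real)^Suc j < x"
  proof -
    obtain j where "(1/2 :: real)^j < x"
      using real_arch_pow_inv[OF \<open>0 < x\<close>, of "1/2"] by auto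
    moreover have "(1/2 :: real)^Suc j \<le> (1/2)^j"
      by (rule power_decreasing) auto
    ultimately show ?thesis
      by (intro exI[of _ j]) linarith
  qed
  then obtain j where j: "(1/2 :: real)^Suc j < x" "\<And>i. i < j \<Longrightarrow> \<not> (1/2 :: real)^Suc i < x"
    using exists_least_iff[of "\<lambda>j. (1/2 :: real)^Suc j < x"] by blast
  have "min 1 (x\<^sup>2) \<le> (1/4)^j"
  proof (cases j)
    case (Suc i)
    then have "x \<le> (1/2)^j"
      using j(2)[of i] by simp
    then have "x\<^sup>2 \<le> ((1/2)^j)\<^sup>2"
      using assms by (intro power_mono)
    also have "\<dots> = (1/4)^j"
      by (simp add: power2_eq_square power_mult_distrib[symmetric])
    finally show ?thesis by simp
  qed simp
  then have "ennreal (min 1 (x\<^sup>2)) \<le> ennreal ((1/4)^j) * indicator {y. (1/2)^Suc j < y} x"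
    using j(1) by (simp add: ennreal_leI)
  also have "\<dots> \<le> (\<Sum>j. ennreal ((1/4)^j) * indicator {y. (1/2)^Suc j < y} x)" (is "?g j \<le> suminf ?g")
  proof -
    have "g j \<le> suminf g" for g :: "nat \<Rightarrow> ennreal"
      using sum_le_suminf[of g "{j}"] by simp
    then show ?thesis .
  qed
  finally show ?thesis .
qed simp

text \<open>
  The dyadic level \<open>2\<^bsup>-j\<^esup>\<close> contributes at most a constant times \<open>4\<^bsup>-j\<^esup> 2\<^bsup>aj\<^esup>\<close>, a geometric series
  because \<open>a < 2\<close>.
\<close>
lemma nn_integral_min_square_finite_of_tail:
  fixes R :: "'z \<Rightarrow> real"
  assumes [measurable]: "R \<in> borel_measurable M" and R: "\<And>z. 0 \<le> R z"
    and tail: "\<And>u. 0 < u \<Longrightarrow> emeasure M {z\<in>space M. u < R z} \<le> ennreal (K * u powr (- a))"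
    and K: "0 \<le> K" and a: "a < 2"
  shows "(\<integral>\<^sup>+z. ennreal (min 1 ((R z)\<^sup>2)) \<partial>M) < \<infinity>"
proof -
  \<comment> \<open>The ratio of the geometric series; \<open>a < 2\<close> makes it less than 1.\<close>
  define q where "q = 2 powr a / 4"
  have q: "0 < q" "q < 1"
    using powr_less_mono[OF a, of 2] by (simp_all add: q_def)
  have "(\<integral>\<^sup>+z. ennreal (min 1 ((R z)\<^sup>2)) \<partial>M)
     \<le> (\<integral>\<^sup>+z. (\<Sum>j. ennreal ((1/4)^j) * indicator {z\<in>space M. (1/2)^Suc j < R z} z) \<partial>M)"
    by (rule nn_integral_mono) (use min_one_square_le_dyadic_sum[OF R] in \<open>simp add: indicator_def\<close>)
  also have "\<dots> = (\<Sum>j. ennreal ((1/4)^j) * emeasure M {z\<in>space M. (1/2)^Suc j < R z})"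
    by (subst nn_integral_suminf) (auto intro!: suminf_cong nn_integral_cmult_indicator)
  also have "\<dots> \<le> (\<Sum>j. ennreal (K * 2 powr a * q^j))"
  proof (rule suminf_le)
    fix j
    have "(1/2 :: real)^Suc j = 2 powr (- real (Suc j))"
      by (subst powr_minus, subst powr_realpow) (simp_all add: power_one_over inverse_eq_divide)
    then have "((1/2 :: real)^Suc j) powr (- a) = 2 powr a * (2 powr a)^j"
      by (simp add: powr_powr powr_realpow[symmetric] powr_add[symmetric] algebra_simps)
    then have "(1/4)^j * (K * ((1/2)^Suc j) powr (- a)) = K * 2 powr a * q^j"
      by (simp add: q_def power_divide)
    then have eq: "ennreal ((1/4)^j) * ennreal (K * ((1/2)^Suc j) powr (- a)) = ennreal (K * 2 powr a * q^j)"
      by (simp only: ennreal_mult'[symmetric] zero_le_power zero_le_divide_1_iff zero_le_numeral)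
    show "ennreal ((1/4)^j) * emeasure M {z\<in>space M. (1/2)^Suc j < R z} \<le> ennreal (K * 2 powr a * q^j)"
      by (subst eq[symmetric]) (intro mult_left_mono tail, simp_all)
  qed auto
  also have "\<dots> < \<infinity>"
    using q K by (subst suminf_ennreal2) (auto intro!: summable_mult summable_geometric)
  finally show ?thesis .
qed


text \<open>
  A term of the series without its sign, as a function of the arrival time \<open>y\<close> and the mark \<open>x\<close>.
\<close>
definition lepage_term :: "real \<Rightarrow> ('e \<Rightarrow> real) \<Rightarrow> ('e \<Rightarrow> real) \<Rightarrow> real \<Rightarrow> 'e \<Rightarrow> real" where
  "lepage_term a r f y x = y powr (- 1 / a) * r x powr (1 / a) * f x"

text \<open>
  For \<open>y > 0\<close> this is the inequality \<open>u < \<bar>lepage_term a r f y x\<bar>\<close> solved for \<open>y\<close>. For \<open>y \<le> 0\<close>,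
  whatever the value of \<open>powr\<close> at \<open>y\<close> is, the hypothesis forces \<open>f x \<noteq> 0\<close>, so that the right-hand side is
  positive.
\<close>
lemma lepage_term_gt_imp:
  assumes "0 < a" "0 < r x" "0 < u" "u < \<bar>lepage_term a r f y x\<bar>"
  shows "y < r x * \<bar>f x\<bar> powr a * u powr (- a)"
proof (cases "0 < y")
  case True
  have "u powr a < \<bar>lepage_term a r f y x\<bar> powr a"
    using assms by (intro powr_less_mono2) auto
  also have "\<dots> = (y powr (- 1 / a)) powr a * (r x powr (1 / a)) powr a * \<bar>f x\<bar> powr a"
    by (simp add: lepage_term_def abs_mult powr_mult)
  also have "\<dots> = r x * \<bar>f x\<bar> powr a / y"
  proof -
    have "(y powr (- 1 / a)) powr a = 1 / y"
      using assms True by (simp only: powr_powr) (simp add: powr_minus_divide)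
    with assms show ?thesis by (simp add: powr_powr)
  qed
  finally show ?thesis
    using True assms by (simp add: powr_minus field_simps)
next
  case False
  moreover have "f x \<noteq> 0"
    using assms by (auto simp: lepage_term_def)
  then have "0 < r x * \<bar>f x\<bar> powr a * u powr (- a)"
    using assms by simp
  ultimately show ?thesis by linarith
qed

lemma summable_square_of_min_one:
  fixes x :: "nat \<Rightarrow> real"
  assumes "(\<Sum>k. ennreal (min 1 ((x k)\<^sup>2))) \<noteq> \<infinity>"
  shows "summable (\<lambda>k. (x k)\<^sup>2)"
proof -
  have s: "summable (\<lambda>k. min 1 ((x k)\<^sup>2))"
    using assms by (intro summable_suminf_not_top) auto
  then have "eventually (\<lambda>k. min 1 ((x k)\<^sup>2) < 1) sequentially"
    by (intro order_tendstoD(2)[OF summable_LIMSEQ_zero[OF s]]) simp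
  then have "eventually (\<lambda>k. min 1 ((x k)\<^sup>2) = (x k)\<^sup>2) sequentially"
    by eventually_elim auto
  with s show ?thesis
    by (subst (asm) summable_cong)
qed

lemma abs_sin_sum_le: "\<bar>sin (\<Sum>j\<in>J. z j)\<bar> \<le> (\<Sum>j\<in>J. \<bar>sin (z j :: real)\<bar>)"
proof (induction J rule: infinite_finite_induct)
  case (insert j J)
  have "\<bar>sin (z j + (\<Sum>j\<in>J. z j))\<bar> \<le> \<bar>sin (z j) * cos (\<Sum>j\<in>J. z j)\<bar> + \<bar>cos (z j) * sin (\<Sum>j\<in>J. z j)\<bar>"
    unfolding sin_add by (rule abs_triangle_ineq)
  also have "\<dots> \<le> \<bar>sin (z j)\<bar> * 1 + 1 * \<bar>sin (\<Sum>j\<in>J. z j)\<bar>"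
    unfolding abs_mult by (intro add_mono mult_mono) auto
  finally show ?case using insert by simp
qed simp_all

text \<open>
  Subadditivity of \<open>\<bar>sin\<bar>\<close> reduces a linear combination to its terms.
\<close>
lemma one_minus_cos_sum_le:
  fixes c l :: "'j \<Rightarrow> real"
  shows "1 - cos (\<Sum>j\<in>J. c j * l j) \<le> (\<Sum>j\<in>J. 2 * real (card J) * (1 + (c j)\<^sup>2) * min 1 ((l j)\<^sup>2))"
proof -
  let ?z = "\<lambda>j. c j * l j / 2"
  have "(\<Sum>j\<in>J. c j * l j) = 2 * (\<Sum>j\<in>J. ?z j)"
    by (simp add: sum_distrib_left)
  then have half: "1 - cos (\<Sum>j\<in>J. c j * l j) = 2 * (sin (\<Sum>j\<in>J. ?z j))\<^sup>2"
    by (simp add: cos_double_sin)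
  have "(sin (\<Sum>j\<in>J. ?z j))\<^sup>2 \<le> (\<Sum>j\<in>J. \<bar>sin (?z j)\<bar>)\<^sup>2"
    using power_mono[OF abs_sin_sum_le[of ?z J], of 2] by simp
  also have "\<dots> \<le> (\<Sum>j\<in>J. \<bar>sin (?z j)\<bar>\<^sup>2) * real (card J)"
    by (rule sum_squared_le_sum_of_squares)
  also have "\<dots> \<le> (\<Sum>j\<in>J. (1 + (c j)\<^sup>2) * min 1 ((l j)\<^sup>2)) * real (card J)"
  proof (intro mult_right_mono sum_mono)
    fix j
    have "(sin (?z j))\<^sup>2 \<le> (?z j)\<^sup>2"
      using abs_sin_x_le_abs_x[of "?z j"] by (simp only: abs_le_square_iff)
    also have "\<dots> \<le> (1 + (c j)\<^sup>2) * (l j)\<^sup>2"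
      by (simp add: power_mult_distrib power_divide algebra_simps)
    finally have "(sin (?z j))\<^sup>2 \<le> (1 + (c j)\<^sup>2) * (l j)\<^sup>2" .
    moreover have "(sin (?z j))\<^sup>2 \<le> 1"
      by (simp add: abs_square_le_1)
    then have "(sin (?z j))\<^sup>2 \<le> (1 + (c j)\<^sup>2) * 1"
      by (rule order_trans) simp
    ultimately show "\<bar>sin (?z j)\<bar>\<^sup>2 \<le> (1 + (c j)\<^sup>2) * min 1 ((l j)\<^sup>2)"
      by (simp add: min_def)
  qed simp
  finally have "1 - cos (\<Sum>j\<in>J. c j * l j)
      \<le> 2 * ((\<Sum>j\<in>J. (1 + (c j)\<^sup>2) * min 1 ((l j)\<^sup>2)) * real (card J))"
    unfolding half by simp
  also have "\<dots> = (\<Sum>j\<in>J. 2 * real (card J) * (1 + (c j)\<^sup>2) * min 1 ((l j)\<^sup>2))"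
    by (simp only: sum_distrib_left sum_distrib_right mult_ac)
  finally show ?thesis .
qed

locale reweighted_measure =
  fixes m :: "'e measure" and r :: "'e \<Rightarrow> real"
  assumes measurable_r [measurable]: "r \<in> borel_measurable m"
    and r_pos: "x \<in> space m \<Longrightarrow> 0 < r x"
    and prob_space_weighted: "prob_space (density m (\<lambda>x. ennreal (1 / r x)))"
begin

abbreviation m_hat :: "'e measure" where
  "m_hat \<equiv> density m (\<lambda>x. ennreal (1 / r x))"

lemma nn_integral_m_hat:
  assumes [measurable]: "g \<in> borel_measurable m"
  shows "(\<integral>\<^sup>+x. ennreal (r x) * g x \<partial>m_hat) = (\<integral>\<^sup>+x. g x \<partial>m)"
proof -
  have "(\<integral>\<^sup>+x. ennreal (r x) * g x \<partial>m_hat) = (\<integral>\<^sup>+x. ennreal (1 / r x) * (ennreal (r x) * g x) \<partial>m)"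
    by (rule nn_integral_density) measurable
  also have "\<dots> = (\<integral>\<^sup>+x. g x \<partial>m)"
  proof (rule nn_integral_cong)
    fix x assume "x \<in> space m"
    then have "ennreal (1 / r x) * ennreal (r x) = 1"
      using r_pos[of x] by (simp add: ennreal_mult'[symmetric])
    then show "ennreal (1 / r x) * (ennreal (r x) * g x) = g x"
      by (simp add: mult.assoc[symmetric])
  qed
  finally show ?thesis .
qed

text \<open>
  The density \<open>1 / r\<close> of the law of the marks is the inverse of the Jacobian of \<open>y \<mapsto> r x * y\<close>.
\<close>
lemma nn_integral_rescale:
  fixes g :: "real \<times> 'e \<Rightarrow> ennreal"
  assumes [measurable]: "g \<in> borel_measurable (borel \<Otimes>\<^sub>M m)"
  shows "(\<integral>\<^sup>+y. (\<integral>\<^sup>+x. g (y / r x, x) \<partial>m_hat) * indicator {0<..} y \<partial>lborel)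
       = (\<integral>\<^sup>+x. (\<integral>\<^sup>+y. g (y, x) * indicator {0<..} y \<partial>lborel) \<partial>m)"
proof -
  interpret m_hat: prob_space m_hat by (rule prob_space_weighted)
  interpret pair_sigma_finite lborel m_hat ..
  have "(\<integral>\<^sup>+y. (\<integral>\<^sup>+x. g (y / r x, x) \<partial>m_hat) * indicator {0<..} y \<partial>lborel)
      = (\<integral>\<^sup>+y. \<integral>\<^sup>+x. g (y / r x, x) * indicator {0<..} y \<partial>m_hat \<partial>lborel)"
    by (intro nn_integral_cong nn_integral_multc[symmetric]) measurable
  also have "\<dots> = (\<integral>\<^sup>+x. \<integral>\<^sup>+y. g (y / r x, x) * indicator {0<..} y \<partial>lborel \<partial>m_hat)"
    by (rule Fubini'[symmetric]) measurable
  also have "\<dots> = (\<integral>\<^sup>+x. ennreal (r x) * (\<integral>\<^sup>+y. g (y, x) * indicator {0<..} y \<partial>lborel) \<partial>m_hat)"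
  proof (rule nn_integral_cong)
    fix x assume "x \<in> space m_hat"
    then have x [measurable]: "x \<in> space m" and r: "0 < r x"
      using r_pos by auto
    have "(\<integral>\<^sup>+y. g (y / r x, x) * indicator {0<..} y \<partial>lborel)
        = \<bar>r x\<bar> * (\<integral>\<^sup>+y. g ((0 + r x * y) / r x, x) * indicator {0<..} (0 + r x * y) \<partial>lborel)"
      by (rule nn_integral_real_affine, measurable) (use r in simp)
    also have "\<dots> = ennreal (r x) * (\<integral>\<^sup>+y. g (y, x) * indicator {0<..} y \<partial>lborel)"
      using r by (auto simp: indicator_def zero_less_mult_iff intro!: arg_cong2[where f="(*)"] nn_integral_cong)
    finally show "(\<integral>\<^sup>+y. g (y / r x, x) * indicator {0<..} y \<partial>lborel)
        = ennreal (r x) * (\<integral>\<^sup>+y. g (y, x) * indicator {0<..} y \<partial>lborel)" .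
  qed
  also have "\<dots> = (\<integral>\<^sup>+x. (\<integral>\<^sup>+y. g (y, x) * indicator {0<..} y \<partial>lborel) \<partial>m)"
    by (rule nn_integral_m_hat) measurable
  finally show ?thesis .
qed

lemma lepage_term_measurable [measurable]:
  assumes [measurable]: "f \<in> borel_measurable m"
  shows "(\<lambda>(y, x). lepage_term a r f y x) \<in> borel_measurable (borel \<Otimes>\<^sub>M m)"
  unfolding lepage_term_def by measurable

text \<open>
  The function \<open>Y\<close> stands for the arrival times, with \<open>M\<close> the product of counting measure and
  probability, as well as for the identity on the positive half-line with Lebesgue measure. In both cases
  \<open>M\<close> gives \<open>{Y < c}\<close> mass at most \<open>c\<close>; averaging the threshold of \<open>lepage_term_gt_imp\<close> over the marks
  gives the tail \<open>u powr (- a)\<close> times the integral of \<open>\<bar>f\<bar> powr a\<close>.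
\<close>
lemma nn_integral_lepage_term_finite:
  fixes Y :: "'z \<Rightarrow> real"
  assumes M: "sigma_finite_measure M" and Y [measurable]: "Y \<in> borel_measurable M"
    and Y_le: "\<And>c. 0 \<le> c \<Longrightarrow> emeasure M {z\<in>space M. Y z < c} \<le> ennreal c"
    and f: "f \<in> F_space a m" and a: "0 < a" "a < 2"
  shows "(\<integral>\<^sup>+z. \<integral>\<^sup>+x. ennreal (min 1 ((lepage_term a r f (Y z) x)\<^sup>2)) \<partial>m_hat \<partial>M) < \<infinity>"
proof -
  interpret M: sigma_finite_measure M by (rule M)
  interpret m_hat: prob_space m_hat by (rule prob_space_weighted)
  interpret pair_sigma_finite M m_hat ..
  have [measurable]: "f \<in> borel_measurable m"
    using f by (simp add: F_space_def)
  define I where "I = (\<integral>\<^sup>+x. ennreal (\<bar>f x\<bar> powr a) \<partial>m)"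
  then have I: "I < \<infinity>" using f by (simp add: F_space_def)
  define R where "R = (\<lambda>(z, x). \<bar>lepage_term a r f (Y z) x\<bar>)"
  have R [measurable]: "R \<in> borel_measurable (M \<Otimes>\<^sub>M m_hat)"
    unfolding R_def lepage_term_def by measurable
  have "(\<integral>\<^sup>+p. ennreal (min 1 ((R p)\<^sup>2)) \<partial>(M \<Otimes>\<^sub>M m_hat)) < \<infinity>"
  proof (rule nn_integral_min_square_finite_of_tail[where K="enn2real I" and a=a])
    fix u :: real assume u: "0 < u"
    have "emeasure (M \<Otimes>\<^sub>M m_hat) {p\<in>space (M \<Otimes>\<^sub>M m_hat). u < R p}
        = (\<integral>\<^sup>+x. emeasure M ((\<lambda>z. (z, x)) -` {p\<in>space (M \<Otimes>\<^sub>M m_hat). u < R p}) \<partial>m_hat)"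
      by (rule emeasure_pair_measure_alt2) measurable
    also have "\<dots> \<le> (\<integral>\<^sup>+x. ennreal (r x) * ennreal (\<bar>f x\<bar> powr a * u powr (- a)) \<partial>m_hat)"
    proof (rule nn_integral_mono)
      fix x assume x: "x \<in> space m_hat"
      then have r: "0 < r x" using r_pos by simp
      have "emeasure M ((\<lambda>z. (z, x)) -` {p\<in>space (M \<Otimes>\<^sub>M m_hat). u < R p})
          \<le> emeasure M {z\<in>space M. Y z < r x * \<bar>f x\<bar> powr a * u powr (- a)}"
        using x lepage_term_gt_imp[where a=a and r=r and x=x and u=u and f=f] r u a
        by (intro emeasure_mono) (auto simp: R_def space_pair_measure)
      also have "\<dots> \<le> ennreal (r x * \<bar>f x\<bar> powr a * u powr (- a))"
        using r by (intro Y_le) simp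
      also have "\<dots> = ennreal (r x) * ennreal (\<bar>f x\<bar> powr a * u powr (- a))"
        using r by (simp add: ennreal_mult'[symmetric] mult.assoc)
      finally show "emeasure M ((\<lambda>z. (z, x)) -` {p\<in>space (M \<Otimes>\<^sub>M m_hat). u < R p})
          \<le> ennreal (r x) * ennreal (\<bar>f x\<bar> powr a * u powr (- a))" .
    qed
    also have "\<dots> = (\<integral>\<^sup>+x. ennreal (\<bar>f x\<bar> powr a * u powr (- a)) \<partial>m)"
      by (rule nn_integral_m_hat) measurable
    also have "\<dots> = I * ennreal (u powr (- a))"
      unfolding I_def by (subst nn_integral_multc[symmetric]) (auto simp: ennreal_mult'[symmetric])
    also have "\<dots> = ennreal (enn2real I * u powr (- a))"
      using I by (simp add: ennreal_mult')
    finally show "emeasure (M \<Otimes>\<^sub>M m_hat) {p\<in>space (M \<Otimes>\<^sub>M m_hat). u < R p}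
        \<le> ennreal (enn2real I * u powr (- a))" .
  qed (use a in \<open>auto simp: R_def\<close>)
  also have "(\<integral>\<^sup>+p. ennreal (min 1 ((R p)\<^sup>2)) \<partial>(M \<Otimes>\<^sub>M m_hat))
      = (\<integral>\<^sup>+z. \<integral>\<^sup>+x. ennreal (min 1 ((R (z, x))\<^sup>2)) \<partial>m_hat \<partial>M)"
    by (rule m_hat.nn_integral_fst[symmetric]) measurable
  finally show ?thesis
    by (simp add: R_def)
qed

text \<open>
  The mean of \<open>exp (\<i> * \<epsilon> * \<Phi> y x)\<close> over the sign \<open>\<epsilon>\<close> and the mark \<open>x\<close>.
\<close>
definition mean_cos :: "(real \<Rightarrow> 'e \<Rightarrow> real) \<Rightarrow> real \<Rightarrow> real" where
  "mean_cos \<Phi> y = (\<integral>x. cos (\<Phi> y x) \<partial>m_hat)"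

lemma abs_mean_cos_le_1: "\<bar>mean_cos \<Phi> y\<bar> \<le> 1"
proof -
  interpret mh: prob_space m_hat by (rule prob_space_weighted)
  have "\<bar>mean_cos \<Phi> y\<bar> \<le> (\<integral>x. \<bar>cos (\<Phi> y x)\<bar> \<partial>m_hat)"
    unfolding mean_cos_def by (rule integral_abs_bound)
  also have "\<dots> \<le> (\<integral>x. 1 \<partial>m_hat)"
    by (rule integral_mono') auto
  also have "\<dots> = 1"
    using mh.prob_space by simp
  finally show ?thesis .
qed

lemma measurable_mean_cos [measurable]:
  assumes [measurable]: "(\<lambda>(y, x). \<Phi> y x) \<in> borel_measurable (borel \<Otimes>\<^sub>M m)"
  shows "mean_cos \<Phi> \<in> borel_measurable borel"
proof -
  interpret mh: prob_space m_hat by (rule prob_space_weighted)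
  have "(\<lambda>(y, x). cos (\<Phi> y x)) \<in> borel_measurable (borel \<Otimes>\<^sub>M m_hat)"
    by measurable
  then show ?thesis
    unfolding mean_cos_def[abs_def] by (rule mh.borel_measurable_lebesgue_integral)
qed

lemma continuous_mean_cos:
  assumes [measurable]: "(\<lambda>(y, x). \<Phi> y x) \<in> borel_measurable (borel \<Otimes>\<^sub>M m)"
    and cont: "\<And>x. x \<in> space m \<Longrightarrow> continuous_on {0<..} (\<lambda>y. \<Phi> y x)"
  shows "continuous_on {0<..} (mean_cos \<Phi>)"
  unfolding continuous_on_sequentially
proof safe
  interpret mh: prob_space m_hat by (rule prob_space_weighted)
  fix y and a :: real assume a: "0 < a" "\<forall>n. y n \<in> {0<..}" and lim: "y \<longlonglongrightarrow> a"
  have [measurable]: "\<Phi> y' \<in> borel_measurable m" for y'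
    by measurable
  show "(mean_cos \<Phi> \<circ> y) \<longlonglongrightarrow> mean_cos \<Phi> a"
    unfolding comp_def mean_cos_def
  proof (rule integral_dominated_convergence[where w="\<lambda>_. 1"])
    show "AE x in m_hat. (\<lambda>n. cos (\<Phi> (y n) x)) \<longlonglongrightarrow> cos (\<Phi> a x)"
    proof (rule AE_I2)
      fix x assume "x \<in> space m_hat"
      then have "continuous_on {0<..} (\<lambda>y. \<Phi> y x)"
        using cont by simp
      then have "(\<lambda>n. \<Phi> (y n) x) \<longlonglongrightarrow> \<Phi> a x"
        using a lim unfolding continuous_on_sequentially comp_def by blast
      then show "(\<lambda>n. cos (\<Phi> (y n) x)) \<longlonglongrightarrow> cos (\<Phi> a x)"
        by (rule tendsto_cos)
    qed
  qed auto
qed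

lemma ennreal_one_minus_mean_cos:
  assumes [measurable]: "(\<lambda>(y, x). \<Phi> y x) \<in> borel_measurable (borel \<Otimes>\<^sub>M m)"
  shows "ennreal (1 - mean_cos \<Phi> y) = (\<integral>\<^sup>+x. ennreal (1 - cos (\<Phi> y x)) \<partial>m_hat)"
proof -
  interpret mh: prob_space m_hat by (rule prob_space_weighted)
  have [measurable]: "\<Phi> y \<in> borel_measurable m"
    by measurable
  have int: "integrable m_hat (\<lambda>x. cos (\<Phi> y x))"
    by (rule mh.integrable_const_bound[where B=1]) auto
  have "(\<integral>\<^sup>+x. ennreal (1 - cos (\<Phi> y x)) \<partial>m_hat) = ennreal (\<integral>x. 1 - cos (\<Phi> y x) \<partial>m_hat)"
    using int by (intro nn_integral_eq_integral) auto
  also have "(\<integral>x. 1 - cos (\<Phi> y x) \<partial>m_hat) = 1 - mean_cos \<Phi> y"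
    using int mh.prob_space by (subst Bochner_Integration.integral_diff) (auto simp: mean_cos_def)
  finally show ?thesis by simp
qed

lemma nn_integral_mean_cos_finite:
  fixes f :: "'j \<Rightarrow> 'e \<Rightarrow> real"
  assumes J: "finite J" and f: "\<And>j. j \<in> J \<Longrightarrow> f j \<in> F_space (a j) m"
    and a: "\<And>j. j \<in> J \<Longrightarrow> 0 < a j" "\<And>j. j \<in> J \<Longrightarrow> a j < 2"
  shows "(\<integral>\<^sup>+y. ennreal (1 - mean_cos (\<lambda>y x. \<Sum>j\<in>J. c j * lepage_term (a j) r (f j) y x) y)
      * indicator {0<..} y \<partial>lborel) < \<infinity>"
proof -
  let ?\<Phi> = "\<lambda>y x. \<Sum>j\<in>J. c j * lepage_term (a j) r (f j) y x"
  let ?M = "restrict_space lborel {0::real<..}"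
  interpret mh: prob_space m_hat by (rule prob_space_weighted)
  have f_meas: "f j \<in> borel_measurable m" if "j \<in> J" for j
    using f[OF that] by (simp add: F_space_def)
  have term_meas: "(\<lambda>(y, x). lepage_term (a j) r (f j) y x) \<in> borel_measurable (borel \<Otimes>\<^sub>M m)" if "j \<in> J" for j
    using f_meas[OF that] by (rule lepage_term_measurable)
  have \<Phi>_meas: "(\<lambda>(y, x). ?\<Phi> y x) \<in> borel_measurable (borel \<Otimes>\<^sub>M m)"
    using term_meas by (auto simp: case_prod_beta intro!: borel_measurable_sum borel_measurable_times)
  define q where "q j y x = ennreal (min 1 ((lepage_term (a j) r (f j) y x)\<^sup>2))" for j y x
  define K where "K j = 2 * real (card J) * (1 + (c j)\<^sup>2)" for j
  have q_meas: "(\<lambda>(y, x). q j y x) \<in> borel_measurable (borel \<Otimes>\<^sub>M m)" if "j \<in> J" for j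
  proof -
    note [measurable] = term_meas[OF that]
    show ?thesis unfolding q_def by measurable
  qed
  have q_int_meas: "(\<lambda>y. \<integral>\<^sup>+x. q j y x \<partial>m_hat) \<in> borel_measurable borel" if "j \<in> J" for j
    using q_meas[OF that] by (intro mh.borel_measurable_nn_integral) (simp cong: measurable_cong_sets sets_pair_measure_cong)
  have q_meas2: "q j y \<in> borel_measurable m_hat" if "j \<in> J" for j y
    using measurable_Pair2[OF q_meas[OF that], of y] by simp
  have fin: "(\<integral>\<^sup>+y. \<integral>\<^sup>+x. q j y x \<partial>m_hat \<partial>?M) < \<infinity>" if j: "j \<in> J" for j
    unfolding q_def
  proof (rule nn_integral_lepage_term_finite[OF _ _ _ f[OF j] a[OF j]])
    show "sigma_finite_measure ?M"
      by (rule sigma_finite_measure_restrict_space) (auto simp: lborel.sigma_finite_measure_axioms)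
    show "(\<lambda>y. y) \<in> borel_measurable ?M"
      by (rule measurable_restrict_space1) simp
    fix b :: real assume "0 \<le> b"
    have "{y\<in>space ?M. y < b} = {0<..<b}"
      by (auto simp: space_restrict_space)
    then show "emeasure ?M {y\<in>space ?M. y < b} \<le> ennreal b"
      using \<open>0 \<le> b\<close> by (simp, subst emeasure_restrict_space) auto
  qed
  have "(\<integral>\<^sup>+y. ennreal (1 - mean_cos ?\<Phi> y) * indicator {0<..} y \<partial>lborel)
      = (\<integral>\<^sup>+y. ennreal (1 - mean_cos ?\<Phi> y) \<partial>?M)"
    by (rule nn_integral_restrict_space[symmetric]) simp
  also have "\<dots> \<le> (\<integral>\<^sup>+y. (\<Sum>j\<in>J. ennreal (K j) * (\<integral>\<^sup>+x. q j y x \<partial>m_hat)) \<partial>?M)"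
  proof (rule nn_integral_mono)
    fix y
    have "ennreal (1 - mean_cos ?\<Phi> y) = (\<integral>\<^sup>+x. ennreal (1 - cos (?\<Phi> y x)) \<partial>m_hat)"
      by (rule ennreal_one_minus_mean_cos[OF \<Phi>_meas])
    also have "\<dots> \<le> (\<integral>\<^sup>+x. (\<Sum>j\<in>J. ennreal (K j) * q j y x) \<partial>m_hat)"
    proof (rule nn_integral_mono)
      fix x
      have "ennreal (1 - cos (?\<Phi> y x)) \<le> ennreal (\<Sum>j\<in>J. K j * min 1 ((lepage_term (a j) r (f j) y x)\<^sup>2))"
        unfolding K_def by (intro ennreal_leI one_minus_cos_sum_le)
      also have "\<dots> = (\<Sum>j\<in>J. ennreal (K j) * q j y x)"
        by (subst sum_ennreal[symmetric]) (simp_all add: K_def q_def ennreal_mult'[symmetric])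
      finally show "ennreal (1 - cos (?\<Phi> y x)) \<le> (\<Sum>j\<in>J. ennreal (K j) * q j y x)" .
    qed
    also have "\<dots> = (\<Sum>j\<in>J. ennreal (K j) * (\<integral>\<^sup>+x. q j y x \<partial>m_hat))"
    proof -
      have "(\<lambda>x. ennreal (K j) * q j y x) \<in> borel_measurable m_hat" if "j \<in> J" for j
      proof -
        note [measurable] = q_meas2[OF that]
        show ?thesis by measurable
      qed
      then have "(\<integral>\<^sup>+x. (\<Sum>j\<in>J. ennreal (K j) * q j y x) \<partial>m_hat) = (\<Sum>j\<in>J. \<integral>\<^sup>+x. ennreal (K j) * q j y x \<partial>m_hat)"
        by (rule nn_integral_sum)
      also have "\<dots> = (\<Sum>j\<in>J. ennreal (K j) * (\<integral>\<^sup>+x. q j y x \<partial>m_hat))"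
        by (intro sum.cong refl nn_integral_cmult q_meas2)
      finally show ?thesis .
    qed
    finally show "ennreal (1 - mean_cos ?\<Phi> y) \<le> (\<Sum>j\<in>J. ennreal (K j) * (\<integral>\<^sup>+x. q j y x \<partial>m_hat))" .
  qed
  also have "\<dots> = (\<Sum>j\<in>J. ennreal (K j) * (\<integral>\<^sup>+y. \<integral>\<^sup>+x. q j y x \<partial>m_hat \<partial>?M))"
  proof -
    have qr: "(\<lambda>y. \<integral>\<^sup>+x. q j y x \<partial>m_hat) \<in> borel_measurable ?M" if "j \<in> J" for j
      by (rule measurable_restrict_space1) (simp add: q_int_meas[OF that])
    have "(\<lambda>y. ennreal (K j) * (\<integral>\<^sup>+x. q j y x \<partial>m_hat)) \<in> borel_measurable ?M" if "j \<in> J" for j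
      using qr[OF that] by simp
    then have "(\<integral>\<^sup>+y. (\<Sum>j\<in>J. ennreal (K j) * (\<integral>\<^sup>+x. q j y x \<partial>m_hat)) \<partial>?M)
        = (\<Sum>j\<in>J. \<integral>\<^sup>+y. ennreal (K j) * (\<integral>\<^sup>+x. q j y x \<partial>m_hat) \<partial>?M)"
      by (rule nn_integral_sum)
    also have "\<dots> = (\<Sum>j\<in>J. ennreal (K j) * (\<integral>\<^sup>+y. \<integral>\<^sup>+x. q j y x \<partial>m_hat \<partial>?M))"
      by (intro sum.cong refl nn_integral_cmult qr)
    finally show ?thesis .
  qed
  also have "\<dots> < \<infinity>"
    using fin J by (simp add: ennreal_mult_less_top)
  finally show ?thesis .
qed

text \<open>
  The identity \<open>1 - cos z = 2 * (sin (z / 2))\<^sup>2\<close> and the change of variables \<open>y \<mapsto> y / r x\<close>, carried out for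
  non-negative integrals, which are finite by the preceding bound and hence agree with the Bochner
  integrals.
\<close>
lemma integral_one_minus_mean_cos:
  fixes f :: "'j \<Rightarrow> 'e \<Rightarrow> real"
  assumes J: "finite J" and f: "\<And>j. j \<in> J \<Longrightarrow> f j \<in> F_space (a j) m"
    and a: "\<And>j. j \<in> J \<Longrightarrow> 0 < a j" "\<And>j. j \<in> J \<Longrightarrow> a j < 2"
  shows "(LINT y:{0<..}|lborel. 1 - mean_cos (\<lambda>y x. \<Sum>j\<in>J. c j * lepage_term (a j) r (f j) y x) y)
    = 2 * (LINT x|m. (LINT y:{0<..}|lborel. (sin (\<Sum>j\<in>J. c j / (2 * y powr (1 / a j)) * f j x))\<^sup>2))"
proof -
  define \<Phi> where "\<Phi> = (\<lambda>y x. \<Sum>j\<in>J. c j * lepage_term (a j) r (f j) y x)"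
  define F where "F y x = (\<Sum>j\<in>J. c j / (2 * y powr (1 / a j)) * f j x)" for y x
  have f_meas: "f j \<in> borel_measurable m" if "j \<in> J" for j
    using f[OF that] by (simp add: F_space_def)
  have \<Phi>_meas: "(\<lambda>(y, x). \<Phi> y x) \<in> borel_measurable (borel \<Otimes>\<^sub>M m)"
    unfolding case_prod_beta \<Phi>_def
    using lepage_term_measurable[OF f_meas]
    by (intro borel_measurable_sum borel_measurable_times) (auto simp: case_prod_beta)
  have F_meas [measurable]: "(\<lambda>(y, x). F y x) \<in> borel_measurable (borel \<Otimes>\<^sub>M m)"
    unfolding case_prod_beta F_def
  proof (intro borel_measurable_sum borel_measurable_times)
    fix j assume "j \<in> J"
    note [measurable] = f_meas[OF this]
    show "(\<lambda>p. f j (snd p)) \<in> borel_measurable (borel \<Otimes>\<^sub>M m)" by measurable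
  qed measurable
  define A where "A x = (\<integral>\<^sup>+y. ennreal (2 * (sin (F y x))\<^sup>2) * indicator {0<..} y \<partial>lborel)" for x
  have A_meas [measurable]: "A \<in> borel_measurable m"
    unfolding A_def by measurable
  have "(\<integral>\<^sup>+y. ennreal (1 - mean_cos \<Phi> y) * indicator {0<..} y \<partial>lborel)
      = (\<integral>\<^sup>+y. (\<integral>\<^sup>+x. ennreal (2 * (sin (F (y / r x) x))\<^sup>2) \<partial>m_hat) * indicator {0<..} y \<partial>lborel)"
  proof (rule nn_integral_cong)
    fix y :: real
    have "(\<integral>\<^sup>+x. ennreal (1 - cos (\<Phi> y x)) \<partial>m_hat) = (\<integral>\<^sup>+x. ennreal (2 * (sin (F (y / r x) x))\<^sup>2) \<partial>m_hat)" if y: "0 < y"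
    proof (rule nn_integral_cong)
      fix x assume "x \<in> space m_hat"
      then have r: "0 < r x" using r_pos by simp
      have "\<Phi> y x = 2 * F (y / r x) x"
        unfolding F_def \<Phi>_def sum_distrib_left
      proof (rule sum.cong[OF refl])
        fix j
        show "c j * lepage_term (a j) r (f j) y x = 2 * (c j / (2 * (y / r x) powr (1 / a j)) * f j x)"
          using y r by (simp add: lepage_term_def powr_divide powr_minus_divide)
      qed
      then show "ennreal (1 - cos (\<Phi> y x)) = ennreal (2 * (sin (F (y / r x) x))\<^sup>2)"
        by (simp add: cos_double_sin)
    qed
    then show "ennreal (1 - mean_cos \<Phi> y) * indicator {0<..} y
        = (\<integral>\<^sup>+x. ennreal (2 * (sin (F (y / r x) x))\<^sup>2) \<partial>m_hat) * indicator {0<..} y"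
      by (simp add: ennreal_one_minus_mean_cos[OF \<Phi>_meas] indicator_def)
  qed
  also have "\<dots> = (\<integral>\<^sup>+x. A x \<partial>m)"
    using nn_integral_rescale[of "\<lambda>(y, x). ennreal (2 * (sin (F y x))\<^sup>2)"] by (simp add: A_def)
  finally have nn: "(\<integral>\<^sup>+y. ennreal (1 - mean_cos \<Phi> y) * indicator {0<..} y \<partial>lborel) = (\<integral>\<^sup>+x. A x \<partial>m)" .
  have "(\<integral>\<^sup>+x. A x \<partial>m) \<noteq> \<infinity>"
    using nn_integral_mean_cos_finite[where J=J and f=f and a=a and c=c, OF J f a] unfolding nn[unfolded \<Phi>_def] by simp
  then have A_fin: "AE x in m. A x \<noteq> \<infinity>"
    by (intro nn_integral_PInf_AE) auto
  have nonneg: "0 \<le> 1 - mean_cos \<Phi> y" for y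
    using abs_mean_cos_le_1[of \<Phi> y] by linarith
  have mc [measurable]: "mean_cos \<Phi> \<in> borel_measurable borel"
    by (rule measurable_mean_cos[OF \<Phi>_meas])
  have "(LINT y:{0<..}|lborel. 1 - mean_cos \<Phi> y)
      = enn2real (\<integral>\<^sup>+y. ennreal (indicator {0<..} y *\<^sub>R (1 - mean_cos \<Phi> y)) \<partial>lborel)"
    unfolding set_lebesgue_integral_def by (rule integral_eq_nn_integral) (use nonneg in auto)
  also have "\<dots> = enn2real (\<integral>\<^sup>+x. A x \<partial>m)"
    unfolding nn[symmetric] by (intro arg_cong[where f=enn2real] nn_integral_cong) (simp add: indicator_def)
  also have "\<dots> = enn2real (\<integral>\<^sup>+x. ennreal (enn2real (A x)) \<partial>m)"
    using A_fin by (intro arg_cong[where f=enn2real] nn_integral_cong_AE) (auto simp: less_top)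
  also have "\<dots> = (LINT x|m. enn2real (A x))"
    by (rule integral_eq_nn_integral[symmetric]) auto
  also have "\<dots> = (LINT x|m. 2 * (LINT y:{0<..}|lborel. (sin (F y x))\<^sup>2))"
  proof (rule Bochner_Integration.integral_cong[OF refl])
    fix x assume [measurable]: "x \<in> space m"
    have [measurable]: "(\<lambda>y. F y x) \<in> borel_measurable borel" by measurable
    have "2 * (LINT y:{0<..}|lborel. (sin (F y x))\<^sup>2) = (\<integral>y. indicator {0<..} y *\<^sub>R (2 * (sin (F y x))\<^sup>2) \<partial>lborel)"
      unfolding set_lebesgue_integral_def by (subst integral_mult_right_zero[symmetric]) (simp add: mult_ac)
    also have "\<dots> = enn2real (\<integral>\<^sup>+y. ennreal (indicator {0<..} y *\<^sub>R (2 * (sin (F y x))\<^sup>2)) \<partial>lborel)"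
      by (rule integral_eq_nn_integral) auto
    also have "\<dots> = enn2real (A x)"
      unfolding A_def by (intro arg_cong[where f=enn2real] nn_integral_cong) (simp add: indicator_def)
    finally show "enn2real (A x) = 2 * (LINT y:{0<..}|lborel. (sin (F y x))\<^sup>2)" ..
  qed
  also have "\<dots> = 2 * (LINT x|m. (LINT y:{0<..}|lborel. (sin (F y x))\<^sup>2))"
    by (rule integral_mult_right_zero)
  finally show ?thesis
    unfolding F_def \<Phi>_def .
qed

end

section \<open>Characteristic function of the LePage series\<close>

locale lepage_series = unit_poisson_process P N + random_signs P \<epsilon> + reweighted_measure m r
  for P :: "'w measure" and N \<epsilon> and m :: "'e measure" and r +
  fixes V :: "nat \<Rightarrow> 'w \<Rightarrow> 'e"
  assumes indep_marks: "indep_vars (\<lambda>_. m) V UNIV"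
    and law_marks: "distr P m (V k) = density m (\<lambda>x. ennreal (1 / r x))"
    and indep_triple: "independent_triple P (Pi\<^sub>M UNIV (\<lambda>_. borel)) (\<lambda>\<omega> k. arrival_time N (Suc k) \<omega>)
      (Pi\<^sub>M UNIV (\<lambda>_. m)) (\<lambda>\<omega> k. V k \<omega>) (Pi\<^sub>M UNIV (\<lambda>_. borel)) (\<lambda>\<omega> k. \<epsilon> k \<omega>)"
begin

abbreviation G :: "nat \<Rightarrow> 'w \<Rightarrow> real" where
  "G k \<equiv> arrival_time N (Suc k)"

sublocale triple: independent_triple P "Pi\<^sub>M UNIV (\<lambda>_. borel)" "\<lambda>\<omega> k. G k \<omega>"
  "Pi\<^sub>M UNIV (\<lambda>_. m)" "\<lambda>\<omega> k. V k \<omega>" "Pi\<^sub>M UNIV (\<lambda>_. borel)" "\<lambda>\<omega> k. \<epsilon> k \<omega>"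
  by (rule indep_triple)

lemma measurable_arrival [measurable]: "G k \<in> borel_measurable P"
  using measurable_compose[OF triple.measurable_X measurable_component_singleton[of k UNIV]] by simp

lemma measurable_mark [measurable]: "V k \<in> measurable P m"
  using indep_marks by (simp add: indep_vars_def)

lemma nn_integral_mark:
  assumes [measurable]: "g \<in> borel_measurable m"
  shows "(\<integral>\<^sup>+\<omega>. g (V k \<omega>) \<partial>P) = (\<integral>\<^sup>+x. g x \<partial>m_hat)"
  unfolding law_marks[of k, symmetric] by (rule nn_integral_distr[symmetric]) measurable

lemma integral_mark:
  fixes g :: "'e \<Rightarrow> 'c :: {banach, second_countable_topology}"
  assumes [measurable]: "g \<in> borel_measurable m"
  shows "(\<integral>\<omega>. g (V k \<omega>) \<partial>P) = (\<integral>x. g x \<partial>m_hat)"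
  unfolding law_marks[of k, symmetric] by (rule integral_distr[symmetric]) measurable

text \<open>
  The statement is about the decoupled terms, with arrival times and marks sampled separately, since this
  is the form in which the signs are adjoined.
\<close>
lemma AE_square_summable:
  assumes f: "f \<in> F_space a m" and a: "0 < a" "a < 2"
  shows "AE \<omega>1 in P. AE \<omega>2 in P. summable (\<lambda>k. (lepage_term a r f (G k \<omega>1) (V k \<omega>2))\<^sup>2)"
proof -
  have [measurable]: "f \<in> borel_measurable m"
    using f by (simp add: F_space_def)
  interpret C: sigma_finite_measure "count_space (UNIV :: nat set)"
    by (rule sigma_finite_measure_count_space)
  interpret CP: pair_sigma_finite "count_space (UNIV :: nat set)" P ..
  interpret mh: prob_space m_hat by (rule prob_space_weighted)
  let ?CP = "count_space (UNIV :: nat set) \<Otimes>\<^sub>M P"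
  define q where "q y x = ennreal (min 1 ((lepage_term a r f y x)\<^sup>2))" for y x
  have q [measurable]: "(\<lambda>(y, x). q y x) \<in> borel_measurable (borel \<Otimes>\<^sub>M m)"
    unfolding q_def lepage_term_def by measurable
  have Gm [measurable]: "(\<lambda>z. G (fst z) (snd z)) \<in> borel_measurable ?CP"
    by (rule measurable_pair_measure_countable1) simp_all
  have "(\<integral>\<^sup>+z. \<integral>\<^sup>+x. q (G (fst z) (snd z)) x \<partial>m_hat \<partial>?CP) < \<infinity>"
    unfolding q_def
  proof (rule nn_integral_lepage_term_finite[OF _ Gm _ f a])
    show "sigma_finite_measure ?CP" by (rule CP.sigma_finite_measure_axioms)
    fix c :: real assume c: "0 \<le> c"
    have "emeasure ?CP {z\<in>space ?CP. G (fst z) (snd z) < c}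
        = (\<integral>\<^sup>+k. emeasure P (Pair k -` {z\<in>space ?CP. G (fst z) (snd z) < c}) \<partial>count_space UNIV)"
      by (rule emeasure_pair_measure_alt) measurable
    also have "\<dots> = (\<Sum>k. emeasure P {\<omega>\<in>space P. G k \<omega> < c})"
      by (subst nn_integral_count_space_nat)
         (auto simp: space_pair_measure vimage_def intro!: suminf_cong arg_cong[where f="emeasure P"])
    also have "\<dots> \<le> ennreal c"
      by (rule suminf_arrival_before) fact
    finally show "emeasure ?CP {z\<in>space ?CP. G (fst z) (snd z) < c} \<le> ennreal c" .
  qed
  also have "(\<integral>\<^sup>+z. \<integral>\<^sup>+x. q (G (fst z) (snd z)) x \<partial>m_hat \<partial>?CP)
      = (\<integral>\<^sup>+\<omega>1. \<integral>\<^sup>+k. \<integral>\<^sup>+x. q (G k \<omega>1) x \<partial>m_hat \<partial>count_space UNIV \<partial>P)"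
    by (subst CP.nn_integral_snd[symmetric]) (simp_all add: mh.borel_measurable_nn_integral)
  also have "\<dots> = (\<integral>\<^sup>+\<omega>1. (\<Sum>k. \<integral>\<^sup>+x. q (G k \<omega>1) x \<partial>m_hat) \<partial>P)"
    by (simp add: nn_integral_count_space_nat)
  finally have "AE \<omega>1 in P. (\<Sum>k. \<integral>\<^sup>+x. q (G k \<omega>1) x \<partial>m_hat) \<noteq> \<infinity>"
    by (intro nn_integral_PInf_AE) auto
  then show ?thesis
  proof eventually_elim
    case (elim \<omega>1)
    have "(\<Sum>k. \<integral>\<^sup>+x. q (G k \<omega>1) x \<partial>m_hat) = (\<Sum>k. \<integral>\<^sup>+\<omega>2. q (G k \<omega>1) (V k \<omega>2) \<partial>P)"
      by (intro suminf_cong nn_integral_mark[symmetric]) measurable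
    also have "\<dots> = (\<integral>\<^sup>+\<omega>2. (\<Sum>k. q (G k \<omega>1) (V k \<omega>2)) \<partial>P)"
      by (rule nn_integral_suminf[symmetric]) measurable
    finally have "AE \<omega>2 in P. (\<Sum>k. q (G k \<omega>1) (V k \<omega>2)) \<noteq> \<infinity>"
      using elim by (intro nn_integral_PInf_AE) auto
    then show ?case
      unfolding q_def by eventually_elim (rule summable_square_of_min_one)
  qed
qed

lemma AE_lepage_series_summable:
  assumes f: "f \<in> F_space a m" and a: "0 < a" "a < 2"
  shows "AE \<omega> in P. summable (\<lambda>k. \<epsilon> k \<omega> * lepage_term a r f (G k \<omega>) (V k \<omega>))"
proof -
  have [measurable]: "f \<in> borel_measurable m"
    using f by (simp add: F_space_def)
  let ?Q = "\<lambda>(g, v, s). Cauchy (\<lambda>n. \<Sum>k<n. s k * lepage_term a r f (g k) (v k))"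
  have "AE \<omega> in P. ?Q (\<lambda>k. G k \<omega>, \<lambda>k. V k \<omega>, \<lambda>k. \<epsilon> k \<omega>)"
  proof (rule triple.AE_decouple)
    let ?S = "Pi\<^sub>M UNIV (\<lambda>_. borel) \<Otimes>\<^sub>M (Pi\<^sub>M UNIV (\<lambda>_. m) \<Otimes>\<^sub>M Pi\<^sub>M UNIV (\<lambda>_. borel))
      :: ((nat \<Rightarrow> real) \<times> (nat \<Rightarrow> 'e) \<times> (nat \<Rightarrow> real)) measure"
    have "(\<lambda>p. \<Sum>k<n. snd (snd p) k * lepage_term a r f (fst p k) (fst (snd p) k)) \<in> borel_measurable ?S" for n
      unfolding lepage_term_def by measurable
    then have "{p\<in>space ?S. Cauchy (\<lambda>n. \<Sum>k<n. snd (snd p) k * lepage_term a r f (fst p k) (fst (snd p) k))} \<in> sets ?S"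
      by (rule sets_Collect_Cauchy)
    then show "Measurable.pred ?S ?Q"
      by (simp add: pred_def case_prod_beta)
    show "AE \<omega>1 in P. AE \<omega>2 in P. AE \<omega>3 in P. ?Q (\<lambda>k. G k \<omega>1, \<lambda>k. V k \<omega>2, \<lambda>k. \<epsilon> k \<omega>3)"
      using AE_square_summable[OF f a]
    proof eventually_elim
      case (elim \<omega>1)
      then show ?case
        by eventually_elim (simp add: AE_signed_sum_Cauchy)
    qed
  qed
  then show ?thesis
    by eventually_elim (simp add: summable_iff_convergent Cauchy_convergent_iff)
qed

text \<open>
  The signs are averaged first and then the marks. Discarding the arrivals after \<open>T\<close> replaces their
  factors by 1.
\<close>
lemma char_truncated_lepage_sum:
  assumes [measurable]: "(\<lambda>(y, x). \<Phi> y x) \<in> borel_measurable (borel \<Otimes>\<^sub>M m)"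
  shows "(\<integral>\<omega>. exp (\<i> * complex_of_real (\<Sum>k<n. \<epsilon> k \<omega> * (if G k \<omega> \<le> T then \<Phi> (G k \<omega>) (V k \<omega>) else 0))) \<partial>P)
       = complex_of_real (\<integral>\<omega>. (\<Prod>k<n. if G k \<omega> \<le> T then mean_cos \<Phi> (G k \<omega>) else 1) \<partial>P)"
proof -
  interpret mh: prob_space m_hat by (rule prob_space_weighted)
  let ?c = "\<lambda>g v k. if g k \<le> T then \<Phi> (g k) (v k) else 0"
  let ?\<phi> = "\<lambda>(g, v, s). exp (\<i> * complex_of_real (\<Sum>k<n. s k * ?c g v k))"
  have "(\<integral>\<omega>. ?\<phi> (\<lambda>k. G k \<omega>, \<lambda>k. V k \<omega>, \<lambda>k. \<epsilon> k \<omega>) \<partial>P)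
      = (\<integral>\<omega>1. \<integral>\<omega>2. \<integral>\<omega>3. ?\<phi> (\<lambda>k. G k \<omega>1, \<lambda>k. V k \<omega>2, \<lambda>k. \<epsilon> k \<omega>3) \<partial>P \<partial>P \<partial>P)"
  proof (rule triple.integral_decouple[where C=1])
    show "norm (?\<phi> p) \<le> 1" for p
      by (cases p) (simp add: norm_exp_i_times del: of_real_sum of_real_mult)
    show "?\<phi> \<in> borel_measurable (Pi\<^sub>M UNIV (\<lambda>_. borel) \<Otimes>\<^sub>M (Pi\<^sub>M UNIV (\<lambda>_. m) \<Otimes>\<^sub>M Pi\<^sub>M UNIV (\<lambda>_. borel)))"
      by measurable
  qed
  also have "\<dots> = (\<integral>\<omega>1. \<integral>\<omega>2. complex_of_real (\<Prod>k<n. cos (?c (\<lambda>k. G k \<omega>1) (\<lambda>k. V k \<omega>2) k)) \<partial>P \<partial>P)"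
    by (simp only: prod.case char_signed_sum)
  also have "\<dots> = complex_of_real (\<integral>\<omega>1. \<integral>\<omega>2. (\<Prod>k<n. cos (?c (\<lambda>k. G k \<omega>1) (\<lambda>k. V k \<omega>2) k)) \<partial>P \<partial>P)"
    by (simp only: integral_complex_of_real)
  also have "(\<lambda>\<omega>1. \<integral>\<omega>2. (\<Prod>k<n. cos (?c (\<lambda>k. G k \<omega>1) (\<lambda>k. V k \<omega>2) k)) \<partial>P)
      = (\<lambda>\<omega>1. \<Prod>k<n. if G k \<omega>1 \<le> T then mean_cos \<Phi> (G k \<omega>1) else 1)"
  proof
    fix \<omega>1
    let ?d = "\<lambda>k x. cos (if G k \<omega>1 \<le> T then \<Phi> (G k \<omega>1) x else 0)"
    have d [measurable]: "?d k \<in> borel_measurable m" for k by measurable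
    have "(\<integral>\<omega>2. (\<Prod>k<n. ?d k (V k \<omega>2)) \<partial>P) = (\<Prod>k<n. \<integral>\<omega>2. ?d k (V k \<omega>2) \<partial>P)"
    proof (rule indep_vars_lebesgue_integral)
      have "indep_vars (\<lambda>_. m) V {..<n}"
        using indep_marks by (rule indep_vars_subset) auto
      then show "indep_vars (\<lambda>_. borel) (\<lambda>k \<omega>2. ?d k (V k \<omega>2)) {..<n}"
        by (rule indep_vars_compose2[where M'="\<lambda>_. m"]) (rule d)
      show "integrable P (\<lambda>\<omega>2. ?d k (V k \<omega>2))" for k
        by (rule integrable_const_bound[where B=1]) auto
    qed simp
    also have "\<dots> = (\<Prod>k<n. if G k \<omega>1 \<le> T then mean_cos \<Phi> (G k \<omega>1) else 1)"
    proof (rule prod.cong[OF refl])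
      fix k
      have "(\<integral>\<omega>2. ?d k (V k \<omega>2) \<partial>P) = (\<integral>x. ?d k x \<partial>m_hat)"
        by (rule integral_mark) (rule d)
      then show "(\<integral>\<omega>2. ?d k (V k \<omega>2) \<partial>P) = (if G k \<omega>1 \<le> T then mean_cos \<Phi> (G k \<omega>1) else 1)"
        using mh.prob_space by (simp add: mean_cos_def)
    qed
    finally show "(\<integral>\<omega>2. (\<Prod>k<n. ?d k (V k \<omega>2)) \<partial>P) = (\<Prod>k<n. if G k \<omega>1 \<le> T then mean_cos \<Phi> (G k \<omega>1) else 1)" .
  qed
  finally show ?thesis by simp
qed

lemma AE_arrival_le_iff:
  assumes "0 \<le> T"
  shows "AE \<omega> in P. \<forall>k. G k \<omega> \<le> T \<longleftrightarrow> k < N T \<omega>"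
  using AE_count_unbounded AE_space
  by eventually_elim (auto simp: arrival_time_le_iff[OF _ _ assms] Suc_le_eq)

text \<open>
  Almost surely only finitely many terms have an arrival time up to \<open>T\<close>, so both sides of the truncated
  identity become constant as the number of terms grows.
\<close>
lemma char_lepage_sum_until:
  assumes \<Phi> [measurable]: "(\<lambda>(y, x). \<Phi> y x) \<in> borel_measurable (borel \<Otimes>\<^sub>M m)"
    and cont: "\<And>x. x \<in> space m \<Longrightarrow> continuous_on {0<..} (\<lambda>y. \<Phi> y x)" and T: "0 < T"
  shows "(\<integral>\<omega>. exp (\<i> * complex_of_real (\<Sum>k<N T \<omega>. \<epsilon> k \<omega> * \<Phi> (G k \<omega>) (V k \<omega>))) \<partial>P)
       = complex_of_real (exp (- (LINT y:{0<..T}|lborel. 1 - mean_cos \<Phi> y)))"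
proof -
  define H where "H = mean_cos \<Phi>"
  let ?Z = "\<lambda>n \<omega>. \<Sum>k<n. \<epsilon> k \<omega> * (if G k \<omega> \<le> T then \<Phi> (G k \<omega>) (V k \<omega>) else 0)"
  let ?W = "\<lambda>n \<omega>. \<Prod>k<n. if G k \<omega> \<le> T then H (G k \<omega>) else 1"
  have H_meas [measurable]: "H \<in> borel_measurable borel"
    unfolding H_def by (rule measurable_mean_cos[OF \<Phi>])
  have N_meas: "N T \<in> measurable P (count_space UNIV)"
    using T by (intro measurable_count) simp
  have Z_eq: "?Z n \<omega> = (\<Sum>k<N T \<omega>. \<epsilon> k \<omega> * \<Phi> (G k \<omega>) (V k \<omega>))"
    if "\<forall>k. G k \<omega> \<le> T \<longleftrightarrow> k < N T \<omega>" "N T \<omega> \<le> n" for n \<omega>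
    using that by (intro sum.mono_neutral_cong_right) auto
  have W_eq: "?W n \<omega> = (\<Prod>k<N T \<omega>. H (G k \<omega>))"
    if "\<forall>k. G k \<omega> \<le> T \<longleftrightarrow> k < N T \<omega>" "N T \<omega> \<le> n" for n \<omega>
    using that by (intro prod.mono_neutral_cong_right) auto
  have sum_meas: "(\<lambda>\<omega>. \<Sum>k<N T \<omega>. \<epsilon> k \<omega> * \<Phi> (G k \<omega>) (V k \<omega>)) \<in> borel_measurable P"
    by (rule measurable_compose_countable[where f="\<lambda>n \<omega>. \<Sum>k<n. \<epsilon> k \<omega> * \<Phi> (G k \<omega>) (V k \<omega>)", OF _ N_meas]) measurable
  have prod_meas: "(\<lambda>\<omega>. \<Prod>k<N T \<omega>. H (G k \<omega>)) \<in> borel_measurable P"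
    using T by (intro measurable_random_prod) simp_all
  have W_meas: "?W n \<in> borel_measurable P" for n
  proof (intro borel_measurable_prod)
    fix k
    have "Measurable.pred P (\<lambda>\<omega>. G k \<omega> \<le> T)" by measurable
    then show "(\<lambda>\<omega>. if G k \<omega> \<le> T then H (G k \<omega>) else 1) \<in> borel_measurable P"
      by (intro measurable_If measurable_compose[OF measurable_arrival H_meas]) (simp_all add: pred_def)
  qed
  note ae = AE_arrival_le_iff[OF less_imp_le[OF T]]
  have "(\<lambda>n. \<integral>\<omega>. exp (\<i> * complex_of_real (?Z n \<omega>)) \<partial>P)
      \<longlonglongrightarrow> (\<integral>\<omega>. exp (\<i> * complex_of_real (\<Sum>k<N T \<omega>. \<epsilon> k \<omega> * \<Phi> (G k \<omega>) (V k \<omega>))) \<partial>P)"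
  proof (rule integral_dominated_convergence[where w="\<lambda>_. 1"])
    show "AE \<omega> in P. (\<lambda>n. exp (\<i> * complex_of_real (?Z n \<omega>)))
        \<longlonglongrightarrow> exp (\<i> * complex_of_real (\<Sum>k<N T \<omega>. \<epsilon> k \<omega> * \<Phi> (G k \<omega>) (V k \<omega>)))"
      using ae
    proof eventually_elim
      case (elim \<omega>)
      show ?case
        by (rule tendsto_eventually, rule eventually_sequentiallyI[of "N T \<omega>"]) (simp only: Z_eq[OF elim])
    qed
    show "(\<lambda>\<omega>. exp (\<i> * complex_of_real (\<Sum>k<N T \<omega>. \<epsilon> k \<omega> * \<Phi> (G k \<omega>) (V k \<omega>)))) \<in> borel_measurable P"
      using sum_meas by measurable
    show "AE \<omega> in P. norm (exp (\<i> * complex_of_real (?Z n \<omega>))) \<le> 1" for n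
      by (simp add: norm_exp_i_times del: of_real_sum of_real_mult)
  qed (simp, measurable)
  moreover have "(\<lambda>n. \<integral>\<omega>. ?W n \<omega> \<partial>P) \<longlonglongrightarrow> (\<integral>\<omega>. (\<Prod>k<N T \<omega>. H (G k \<omega>)) \<partial>P)"
  proof (rule integral_dominated_convergence[where w="\<lambda>_. 1"])
    show "AE \<omega> in P. (\<lambda>n. ?W n \<omega>) \<longlonglongrightarrow> (\<Prod>k<N T \<omega>. H (G k \<omega>))"
      using ae
    proof eventually_elim
      case (elim \<omega>)
      show ?case
        by (rule tendsto_eventually, rule eventually_sequentiallyI[of "N T \<omega>"]) (simp only: W_eq[OF elim])
    qed
    have "norm (?W n \<omega>) \<le> 1" for n \<omega>
      unfolding real_norm_def abs_prod by (intro prod_le_1) (auto simp: H_def abs_mean_cos_le_1)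
    then show "AE \<omega> in P. norm (?W n \<omega>) \<le> 1" for n
      by blast
  qed (rule prod_meas, rule W_meas, simp)
  then have "(\<lambda>n. complex_of_real (\<integral>\<omega>. ?W n \<omega> \<partial>P)) \<longlonglongrightarrow> complex_of_real (\<integral>\<omega>. (\<Prod>k<N T \<omega>. H (G k \<omega>)) \<partial>P)"
    by (rule tendsto_of_real)
  ultimately have "(\<integral>\<omega>. exp (\<i> * complex_of_real (\<Sum>k<N T \<omega>. \<epsilon> k \<omega> * \<Phi> (G k \<omega>) (V k \<omega>))) \<partial>P)
      = complex_of_real (\<integral>\<omega>. (\<Prod>k<N T \<omega>. H (G k \<omega>)) \<partial>P)"
    unfolding char_truncated_lepage_sum[OF \<Phi>] H_def[symmetric] by (rule LIMSEQ_unique)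
  also have "(\<integral>\<omega>. (\<Prod>k<N T \<omega>. H (G k \<omega>)) \<partial>P) = exp (- (LINT y:{0<..T}|lborel. 1 - H y))"
    unfolding H_def
    by (rule expectation_prod_arrivals[OF measurable_mean_cos[OF \<Phi>] measurable_arrival abs_mean_cos_le_1
          continuous_mean_cos[OF \<Phi> cont] T])
  finally show ?thesis
    unfolding H_def .
qed

lemma filterlim_count:
  assumes \<omega>: "\<omega> \<in> space P" and ub: "\<forall>k. \<exists>n::nat. k \<le> N (real n) \<omega>"
  shows "filterlim (\<lambda>p. N (real (Suc p)) \<omega>) at_top sequentially"
  unfolding filterlim_at_top
proof
  fix Z
  obtain n :: nat where n: "Z \<le> N (real n) \<omega>" using ub by blast
  show "\<forall>\<^sub>F p in sequentially. Z \<le> N (real (Suc p)) \<omega>"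
  proof (rule eventually_sequentiallyI)
    fix p assume "n \<le> p"
    then have "N (real n) \<omega> \<le> N (real (Suc p)) \<omega>"
      by (intro count_mono[OF \<omega>]) simp_all
    with n show "Z \<le> N (real (Suc p)) \<omega>" by simp
  qed
qed

text \<open>
  The number of arrivals up to \<open>T\<close> tends to infinity with \<open>T\<close>, so the sums over these arrivals converge
  to \<open>S\<close>, and the integrals over \<open>(0, T]\<close> converge by dominated convergence.
\<close>
lemma char_lepage_sum:
  assumes \<Phi> [measurable]: "(\<lambda>(y, x). \<Phi> y x) \<in> borel_measurable (borel \<Otimes>\<^sub>M m)"
    and cont: "\<And>x. x \<in> space m \<Longrightarrow> continuous_on {0<..} (\<lambda>y. \<Phi> y x)"
    and fin: "(\<integral>\<^sup>+y. ennreal (1 - mean_cos \<Phi> y) * indicator {0<..} y \<partial>lborel) < \<infinity>"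
    and S [measurable]: "S \<in> borel_measurable P"
    and conv: "AE \<omega> in P. (\<lambda>n. \<Sum>k<n. \<epsilon> k \<omega> * \<Phi> (G k \<omega>) (V k \<omega>)) \<longlonglongrightarrow> S \<omega>"
  shows "(\<integral>\<omega>. exp (\<i> * complex_of_real (S \<omega>)) \<partial>P)
       = complex_of_real (exp (- (LINT y:{0<..}|lborel. 1 - mean_cos \<Phi> y)))"
proof -
  let ?H = "mean_cos \<Phi>"
  let ?T = "\<lambda>p. real (Suc p)"
  let ?U = "\<lambda>p \<omega>. \<Sum>k<N (?T p) \<omega>. \<epsilon> k \<omega> * \<Phi> (G k \<omega>) (V k \<omega>)"
  have H_meas [measurable]: "?H \<in> borel_measurable borel"
    by (rule measurable_mean_cos[OF \<Phi>])
  have nonneg: "0 \<le> 1 - ?H y" for y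
    using abs_mean_cos_le_1[of \<Phi> y] by linarith
  have U_meas: "?U p \<in> borel_measurable P" for p
    by (rule measurable_compose_countable[where f="\<lambda>n \<omega>. \<Sum>k<n. \<epsilon> k \<omega> * \<Phi> (G k \<omega>) (V k \<omega>)", OF _ measurable_count[OF of_nat_0_le_iff]]) measurable
  have "(\<lambda>p. \<integral>\<omega>. exp (\<i> * complex_of_real (?U p \<omega>)) \<partial>P) \<longlonglongrightarrow> (\<integral>\<omega>. exp (\<i> * complex_of_real (S \<omega>)) \<partial>P)"
  proof (rule integral_dominated_convergence[where w="\<lambda>_. 1"])
    show "AE \<omega> in P. (\<lambda>p. exp (\<i> * complex_of_real (?U p \<omega>))) \<longlonglongrightarrow> exp (\<i> * complex_of_real (S \<omega>))"
      using conv AE_count_unbounded AE_space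
    proof eventually_elim
      case (elim \<omega>)
      have "(\<lambda>p. ?U p \<omega>) \<longlonglongrightarrow> S \<omega>"
        using elim(1) filterlim_count[OF elim(3,2)] by (rule filterlim_compose)
      then show ?case
        by (intro tendsto_intros)
    qed
    show "(\<lambda>\<omega>. exp (\<i> * complex_of_real (?U p \<omega>))) \<in> borel_measurable P" for p
      using U_meas[of p] by measurable
    show "AE \<omega> in P. norm (exp (\<i> * complex_of_real (?U p \<omega>))) \<le> 1" for p
      by (simp add: norm_exp_i_times del: of_real_sum of_real_mult)
  qed simp_all
  moreover have "(\<lambda>p. complex_of_real (exp (- (LINT y:{0<..?T p}|lborel. 1 - ?H y))))
      \<longlonglongrightarrow> complex_of_real (exp (- (LINT y:{0<..}|lborel. 1 - ?H y)))"
  proof (intro tendsto_of_real tendsto_exp tendsto_minus)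
    show "(\<lambda>p. LINT y:{0<..?T p}|lborel. 1 - ?H y) \<longlonglongrightarrow> (LINT y:{0<..}|lborel. 1 - ?H y)"
      unfolding set_lebesgue_integral_def
    proof (rule integral_dominated_convergence[where w="\<lambda>y. indicator {0<..} y *\<^sub>R (1 - ?H y)"])
      show "integrable lborel (\<lambda>y. indicator {0<..} y *\<^sub>R (1 - ?H y))"
      proof (rule integrableI_nonneg)
        have "(\<integral>\<^sup>+y. ennreal (indicator {0<..} y *\<^sub>R (1 - ?H y)) \<partial>lborel)
            = (\<integral>\<^sup>+y. ennreal (1 - ?H y) * indicator {0<..} y \<partial>lborel)"
          by (rule nn_integral_cong) (simp add: indicator_def)
        with fin show "(\<integral>\<^sup>+y. ennreal (indicator {0<..} y *\<^sub>R (1 - ?H y)) \<partial>lborel) < \<infinity>"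
          by simp
      qed (use nonneg in auto)
      show "AE y in lborel. (\<lambda>p. indicator {0<..?T p} y *\<^sub>R (1 - ?H y)) \<longlonglongrightarrow> indicator {0<..} y *\<^sub>R (1 - ?H y)"
      proof (rule AE_I2, rule tendsto_eventually)
        fix y :: real
        obtain n :: nat where n: "y \<le> real n"
          using real_arch_simple by blast
        show "\<forall>\<^sub>F p in sequentially. indicator {0<..?T p} y *\<^sub>R (1 - ?H y) = indicator {0<..} y *\<^sub>R (1 - ?H y)"
          by (rule eventually_sequentiallyI[of n]) (use n in \<open>auto simp: indicator_def\<close>)
      qed
      show "AE y in lborel. norm (indicator {0<..?T p} y *\<^sub>R (1 - ?H y)) \<le> indicator {0<..} y *\<^sub>R (1 - ?H y)" for p
        using nonneg by (intro AE_I2) (auto simp: indicator_def)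
    qed measurable
  qed
  moreover have "(\<integral>\<omega>. exp (\<i> * complex_of_real (?U p \<omega>)) \<partial>P)
      = complex_of_real (exp (- (LINT y:{0<..?T p}|lborel. 1 - ?H y)))" for p
    by (rule char_lepage_sum_until[OF \<Phi> cont]) simp_all
  ultimately show ?thesis
    by (simp add: LIMSEQ_unique)
qed

theorem char_lepage_series:
  fixes f :: "'j \<Rightarrow> 'e \<Rightarrow> real"
  assumes J: "finite J" and f: "\<And>j. j \<in> J \<Longrightarrow> f j \<in> F_space (a j) m"
    and a: "\<And>j. j \<in> J \<Longrightarrow> 0 < a j" "\<And>j. j \<in> J \<Longrightarrow> a j < 2"
  shows "(\<integral>\<omega>. exp (\<i> * complex_of_real (\<Sum>j\<in>J. c j * (\<Sum>k. \<epsilon> k \<omega> * lepage_term (a j) r (f j) (G k \<omega>) (V k \<omega>)))) \<partial>P)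
    = complex_of_real (exp (- 2 * (LINT x|m. (LINT y:{0<..}|lborel.
        (sin (\<Sum>j\<in>J. c j / (2 * y powr (1 / a j)) * f j x))\<^sup>2))))"
proof -
  define \<Phi> where "\<Phi> = (\<lambda>y x. \<Sum>j\<in>J. c j * lepage_term (a j) r (f j) y x)"
  have f_meas: "f j \<in> borel_measurable m" if "j \<in> J" for j
    using f[OF that] by (simp add: F_space_def)
  have \<Phi>_meas: "(\<lambda>(y, x). \<Phi> y x) \<in> borel_measurable (borel \<Otimes>\<^sub>M m)"
    unfolding case_prod_beta \<Phi>_def
    using lepage_term_measurable[OF f_meas]
    by (intro borel_measurable_sum borel_measurable_times) (auto simp: case_prod_beta)
  have "(\<integral>\<omega>. exp (\<i> * complex_of_real (\<Sum>j\<in>J. c j * (\<Sum>k. \<epsilon> k \<omega> * lepage_term (a j) r (f j) (G k \<omega>) (V k \<omega>)))) \<partial>P)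
      = complex_of_real (exp (- (LINT y:{0<..}|lborel. 1 - mean_cos \<Phi> y)))"
  proof (rule char_lepage_sum[OF \<Phi>_meas])
    show "continuous_on {0<..} (\<lambda>y. \<Phi> y x)" for x
      unfolding \<Phi>_def lepage_term_def by (intro continuous_intros) auto
    show "(\<integral>\<^sup>+y. ennreal (1 - mean_cos \<Phi> y) * indicator {0<..} y \<partial>lborel) < \<infinity>"
      unfolding \<Phi>_def by (rule nn_integral_mean_cos_finite[OF J f a])
    show "(\<lambda>\<omega>. \<Sum>j\<in>J. c j * (\<Sum>k. \<epsilon> k \<omega> * lepage_term (a j) r (f j) (G k \<omega>) (V k \<omega>))) \<in> borel_measurable P"
    proof (rule borel_measurable_sum)
      fix j assume "j \<in> J"
      note [measurable] = f_meas[OF this]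
      show "(\<lambda>\<omega>. c j * (\<Sum>k. \<epsilon> k \<omega> * lepage_term (a j) r (f j) (G k \<omega>) (V k \<omega>))) \<in> borel_measurable P"
        unfolding lepage_term_def by measurable
    qed
    have "AE \<omega> in P. \<forall>j\<in>J. summable (\<lambda>k. \<epsilon> k \<omega> * lepage_term (a j) r (f j) (G k \<omega>) (V k \<omega>))"
      using J f a by (simp add: AE_finite_all AE_lepage_series_summable)
    then show "AE \<omega> in P. (\<lambda>n. \<Sum>k<n. \<epsilon> k \<omega> * \<Phi> (G k \<omega>) (V k \<omega>))
        \<longlonglongrightarrow> (\<Sum>j\<in>J. c j * (\<Sum>k. \<epsilon> k \<omega> * lepage_term (a j) r (f j) (G k \<omega>) (V k \<omega>)))"
    proof eventually_elim
      case (elim \<omega>)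
      have "(\<lambda>k. \<Sum>j\<in>J. c j * (\<epsilon> k \<omega> * lepage_term (a j) r (f j) (G k \<omega>) (V k \<omega>)))
          sums (\<Sum>j\<in>J. c j * (\<Sum>k. \<epsilon> k \<omega> * lepage_term (a j) r (f j) (G k \<omega>) (V k \<omega>)))"
        using elim by (intro sums_sum sums_mult summable_sums) blast
      then show ?case
        by (simp add: sums_def \<Phi>_def sum_distrib_left mult_ac)
    qed
  qed
  also have "(LINT y:{0<..}|lborel. 1 - mean_cos \<Phi> y)
      = 2 * (LINT x|m. (LINT y:{0<..}|lborel. (sin (\<Sum>j\<in>J. c j / (2 * y powr (1 / a j)) * f j x))\<^sup>2))"
    unfolding \<Phi>_def by (rule integral_one_minus_mean_cos[OF J f a])
  finally show ?thesis by simp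
qed

end

section \<open>Characteristic function of the localised process\<close>

theorem proposition11:
  fixes m :: "'e measure" and P :: "'w measure"
    and r :: "'e \<Rightarrow> real" and \<alpha> b :: "real \<Rightarrow> real" and c d :: real
    and f :: "real \<Rightarrow> real \<Rightarrow> 'e \<Rightarrow> real"
    and N :: "real \<Rightarrow> 'w \<Rightarrow> nat" and \<Gamma> \<gamma> :: "nat \<Rightarrow> 'w \<Rightarrow> real" and V :: "nat \<Rightarrow> 'w \<Rightarrow> 'e"
    and m_hat :: "'e measure"
    and X :: "real \<Rightarrow> real \<Rightarrow> 'w \<Rightarrow> real" and Y :: "real \<Rightarrow> 'w \<Rightarrow> real"
    and n :: nat and \<theta> t :: "nat \<Rightarrow> real"
  assumes "sigma_finite_measure m"
    and "prob_space P"
    and "r \<in> borel_measurable m" and "\<forall>x\<in>space m. 0 < r x"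
    and m_hat: "m_hat = density m (\<lambda>x. ennreal (1 / r x))" and "prob_space m_hat"
    and "range \<alpha> \<subseteq> {c..d}" and "{c..d} \<subseteq> {0<..<2}"
    and "\<alpha> C1_differentiable_on UNIV" and "b C1_differentiable_on UNIV"
    and "\<forall>s u. f s u \<in> F_space (\<alpha> u) m"
    and "poisson_process P 1 N"
    and "\<forall>k\<ge>1. \<forall>\<omega>\<in>space P. \<Gamma> k \<omega> = arrival_time N k \<omega>"
    and "iid_with_law P m m_hat V {1..}"
    and "prob_space.indep_vars P (\<lambda>_. borel) \<gamma> {1..}"
    and "\<forall>k\<ge>1. measure P {\<omega>\<in>space P. \<gamma> k \<omega> = 1} = 1/2 \<and>
                 measure P {\<omega>\<in>space P. \<gamma> k \<omega> = - 1} = 1/2"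
    and "indep_three_seqs P borel \<Gamma> m V borel \<gamma>"
    and X: "\<forall>s u. \<forall>\<omega>\<in>space P. X s u \<omega> = b u * C_stable (\<alpha> u) powr (1 / \<alpha> u) *
          (\<Sum>k. \<gamma> (Suc k) \<omega> * \<Gamma> (Suc k) \<omega> powr (- 1 / \<alpha> u) *
                r (V (Suc k) \<omega>) powr (1 / \<alpha> u) * f s u (V (Suc k) \<omega>))"
    and Y: "\<forall>s. Y s = X s s"
  shows "(LINT \<omega>|P. exp (\<i> * complex_of_real (\<Sum>j=1..n. \<theta> j * Y (t j) \<omega>)))
    = complex_of_real (exp (- 2 * (LINT x|m. (LBINT y:{0<..}.
        (sin (\<Sum>j=1..n. \<theta> j * b (t j) *
           (C_stable (\<alpha> (t j)) powr (1 / \<alpha> (t j)) / (2 * y powr (1 / \<alpha> (t j)))) *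
           f (t j) (t j) x))\<^sup>2))))"
proof -
  interpret P: prob_space P by fact
  define V' where "V' = (\<lambda>k. V (Suc k))"
  define \<epsilon> where "\<epsilon> = (\<lambda>k. \<gamma> (Suc k))"
  note \<Gamma> = assms(13) and iid = assms(14) and signs = assms(15,16) and three = assms(17)
  have \<alpha>: "0 < \<alpha> u" "\<alpha> u < 2" for u
  proof -
    have "\<alpha> u \<in> {c..d}" using assms(7) by blast
    then have "\<alpha> u \<in> {0<..<2}" using assms(8) by blast
    then show "0 < \<alpha> u" "\<alpha> u < 2" by auto
  qed
  have V: "P.indep_vars (\<lambda>_. m) V {1..}" "\<And>k. 1 \<le> k \<Longrightarrow> distr P m (V k) = m_hat"
    using iid by (auto simp: iid_with_law_def)
  let ?E = "\<lambda>X S. {(\<lambda>\<omega> k. X (Suc k) \<omega>) -` A \<inter> space P | A. A \<in> sets (Pi\<^sub>M UNIV (\<lambda>_. S))}"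
  have three_sets: "P.indep_sets (\<lambda>i. [seq_events P borel \<Gamma>, seq_events P m V, seq_events P borel \<gamma>] ! i) {0, 1, 2::nat}"
    using three by (simp add: indep_three_seqs_def)
  then have ev: "seq_events P borel \<Gamma> \<subseteq> P.events" "seq_events P m V \<subseteq> P.events" "seq_events P borel \<gamma> \<subseteq> P.events"
    by (auto simp: P.indep_sets_def)
  have V_space: "V k \<omega> \<in> space m" if "1 \<le> k" "\<omega> \<in> space P" for k \<omega>
    using V(1) that by (auto simp: P.indep_vars_def dest: measurable_space)
  note \<Gamma>_seq = measurable_of_seq_events[OF ev(1), simplified]
  note V_seq = measurable_of_seq_events[OF ev(2) V_space]
  note \<gamma>_seq = measurable_of_seq_events[OF ev(3), simplified]
  have \<Gamma>_arrival: "(\<lambda>k. \<Gamma> (Suc k) \<omega>) = (\<lambda>k. arrival_time N (Suc k) \<omega>)" if "\<omega> \<in> space P" for \<omega>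
    using \<Gamma> that by auto
  have "P.indep_sets (\<lambda>i. [?E \<Gamma> borel, ?E V m, ?E \<gamma> borel] ! i) {0, 1, 2::nat}"
    by (rule P.indep_sets_mono_sets[OF three_sets]) (use \<Gamma>_seq(2) V_seq(2) \<gamma>_seq(2) in auto)
  moreover have "?E \<Gamma> borel = {(\<lambda>\<omega> k. arrival_time N (Suc k) \<omega>) -` A \<inter> space P | A. A \<in> sets (Pi\<^sub>M UNIV (\<lambda>_. borel))}"
  proof -
    have "(\<lambda>\<omega> k. \<Gamma> (Suc k) \<omega>) -` A \<inter> space P = (\<lambda>\<omega> k. arrival_time N (Suc k) \<omega>) -` A \<inter> space P" for A
      using \<Gamma>_arrival by auto
    then show ?thesis by simp
  qed
  ultimately have indep: "P.indep_sets (\<lambda>i. [{(\<lambda>\<omega> k. arrival_time N (Suc k) \<omega>) -` A \<inter> space P | A. A \<in> sets (Pi\<^sub>M UNIV (\<lambda>_. borel))},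
      ?E V m, ?E \<gamma> borel] ! i) {0, 1, 2::nat}"
    by simp
  have arrival_meas: "(\<lambda>\<omega> k. arrival_time N (Suc k) \<omega>) \<in> measurable P (Pi\<^sub>M UNIV (\<lambda>_. borel))"
    using \<Gamma>_seq(1) by (subst measurable_cong[OF \<Gamma>_arrival[symmetric]])
  have "unit_poisson_process P N"
    by (intro unit_poisson_process.intro unit_poisson_process_axioms.intro) fact+
  moreover have "random_signs P \<epsilon>"
  proof (intro random_signs.intro random_signs_axioms.intro)
    show "P.indep_vars (\<lambda>_. borel) \<epsilon> UNIV"
      unfolding \<epsilon>_def by (rule P.indep_vars_shift_index) (rule signs(1))
    show "P.prob {\<omega> \<in> space P. \<epsilon> k \<omega> = 1} = 1 / 2" "P.prob {\<omega> \<in> space P. \<epsilon> k \<omega> = - 1} = 1 / 2" for k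
      using signs(2) by (simp_all add: \<epsilon>_def)
  qed fact
  moreover have "reweighted_measure m r"
  proof (rule reweighted_measure.intro)
    show "0 < r x" if "x \<in> space m" for x
      using that assms(4) by blast
    show "prob_space (density m (\<lambda>x. ennreal (1 / r x)))"
      using assms(5,6) by simp
  qed fact+
  moreover have "lepage_series_axioms P N \<epsilon> m r V'"
  proof (rule lepage_series_axioms.intro)
    show "P.indep_vars (\<lambda>_. m) V' UNIV"
      unfolding V'_def by (rule P.indep_vars_shift_index) (rule V(1))
    show "distr P m (V' k) = density m (\<lambda>x. ennreal (1 / r x))" for k
      using V(2) m_hat by (simp add: V'_def)
    show "independent_triple P (Pi\<^sub>M UNIV (\<lambda>_. borel)) (\<lambda>\<omega> k. arrival_time N (Suc k) \<omega>)
        (Pi\<^sub>M UNIV (\<lambda>_. m)) (\<lambda>\<omega> k. V' k \<omega>) (Pi\<^sub>M UNIV (\<lambda>_. borel)) (\<lambda>\<omega> k. \<epsilon> k \<omega>)"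
      unfolding V'_def \<epsilon>_def
      by (intro independent_triple.intro independent_triple_axioms.intro
          arrival_meas V_seq(1) \<gamma>_seq(1) indep P.prob_space_axioms)
  qed
  ultimately interpret lepage_series P N \<epsilon> m r V'
    by (rule lepage_series.intro)
  define K where "K u = C_stable (\<alpha> u) powr (1 / \<alpha> u)" for u
  \<comment> \<open>All deterministic factors of the \<open>j\<close>-th term, so that both sides depend on the normalising constant
    only through \<open>c'\<close>.\<close>
  define c' where "c' j = \<theta> j * b (t j) * K (t j)" for j
  have "(LINT \<omega>|P. exp (\<i> * complex_of_real (\<Sum>j=1..n. \<theta> j * Y (t j) \<omega>)))
      = (LINT \<omega>|P. exp (\<i> * complex_of_real (\<Sum>j=1..n. c' j *
          (\<Sum>k. \<epsilon> k \<omega> * lepage_term (\<alpha> (t j)) r (f (t j) (t j)) (arrival_time N (Suc k) \<omega>) (V' k \<omega>)))))"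
  proof (rule Bochner_Integration.integral_cong[OF refl])
    fix \<omega> assume \<omega>: "\<omega> \<in> space P"
    have "\<theta> j * Y (t j) \<omega> = c' j *
        (\<Sum>k. \<epsilon> k \<omega> * lepage_term (\<alpha> (t j)) r (f (t j) (t j)) (arrival_time N (Suc k) \<omega>) (V' k \<omega>))" for j
      using \<omega> \<Gamma> X Y by (simp add: c'_def K_def \<epsilon>_def V'_def lepage_term_def mult_ac)
    then show "exp (\<i> * complex_of_real (\<Sum>j=1..n. \<theta> j * Y (t j) \<omega>))
        = exp (\<i> * complex_of_real (\<Sum>j=1..n. c' j *
          (\<Sum>k. \<epsilon> k \<omega> * lepage_term (\<alpha> (t j)) r (f (t j) (t j)) (arrival_time N (Suc k) \<omega>) (V' k \<omega>))))"
      by presburger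
  qed
  also have "\<dots> = complex_of_real (exp (- 2 * (LINT x|m. (LBINT y:{0<..}.
        (sin (\<Sum>j=1..n. c' j / (2 * y powr (1 / \<alpha> (t j))) * f (t j) (t j) x))\<^sup>2))))"
    using assms(11) \<alpha> by (intro char_lepage_series) simp_all
  finally show ?thesis
    by (simp add: c'_def K_def mult.assoc)
qed

end
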